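(* Let $X$ be a complex Banach space and let $Q \in \mathcal{L}(X)$ be a quasinilpotent operator. Then: (i) $\mathcal{R}_Q = \mathcal{B}_Q^\circ \cup \{0\}$ and $\partial\mathcal{R}_Q = \partial\mathcal{B}_Q^\circ \cup \{0\}$; (ii) $\mathcal{R}_Q \neq \{0\}$ if and only if the set $\mathcal{B}_Q^\circ$ is a non-empty open sector; and (iii) either $\mathcal{R}_Q = \{0\}$, $\mathcal{R}_Q = \mathbb{C}$ (i.e., $Q=0$), or there exist $\phi \in [-\pi,\pi)$ and $\theta \in (0,\pi/2]$ such that $\mathcal{R}_Q = e^{i\phi}\Sigma_\theta \cup \{0\}$.
   Context: $\mathcal{L}(X)$ is the algebra of bounded linear operators on $X$; $Q$ is quasinilpotent if $\sigma(Q)=\{0\}$. For $A\subset\mathbb{C}$, $A^\circ$ denotes its (open) interior and $\partial A$ its boundary; $\partial\mathcal{B}_Q^\circ$ is the boundary of $\mathcal{B}_Q^\circ$. Sectors are convex subsets of $\mathbb{C}$ that consist of full rays (a set $A$ consists of full rays if $rz\in A$ whenever $z\in A$ and $r>0$). The balanced open sectors are $\Sigma_\theta := \{re^{i\theta_0}: r>0,\ \theta_0\in(-\theta,\theta)\}$ for $0<\theta<\pi$, and general open sectors are the sets $e^{i\phi}\Sigma_\theta$ with $\phi\in[-\pi,\pi)$ and $\theta\in(0,\pi)$. $\mathcal{B}_Q := \{ z \in \mathbb{C} : \sup_{j\in\mathbb{N}}\|(I+zQ)^j\|<\infty\}$; $\mathcal{R}_Q := \{ z \in \mathbb{C} : \sup_{\mathrm{Re}\,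 s>-1/2}\|(I-szQ)^{-1}\|<\infty\}$.
   Formalization: In (i) the identity ∂R_Q = ∂B_Q° ∪ {0} is stated only for Q ≠ 0, since for Q = 0 one has R_Q = B_Q = ℂ with empty boundary; in (ii) "open sector" means an open convex set of full rays, so ℂ counts as one when Q = 0. *)

theory Defs
  imports "HOL-Analysis.Analysis"
begin

text \<open>
  Complex Banach spaces: a real Banach space with a compatible complex scalar
  multiplication. The law \<open>1 *\<^sub>C x = x\<close> is the case \<open>r = 1\<close> of \<open>scaleC_of_real\<close>.
\<close>

class complex_banach = banach +
  fixes scaleC :: "complex \<Rightarrow> 'a \<Rightarrow> 'a"  (infixr "*\<^sub>C" 75)
  assumes scaleC_add_right: "c *\<^sub>C (x + y) = c *\<^sub>C x + c *\<^sub>C y"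
    and scaleC_add_left: "(c + d) *\<^sub>C x = c *\<^sub>C x + d *\<^sub>C x"
    and scaleC_scaleC: "c *\<^sub>C d *\<^sub>C x = (c * d) *\<^sub>C x"
    and scaleC_of_real: "complex_of_real r *\<^sub>C x = r *\<^sub>R x"
    and norm_scaleC: "norm (c *\<^sub>C x) = cmod c * norm x"

text \<open>
  Elements of the operator algebra are functions satisfying \<open>bounded_clinear\<close>.
  Their operator norm is \<open>onorm\<close>, which does not depend on whether the scalars
  are taken to be real or complex.
\<close>

definition bounded_clinear :: "('a::complex_banach \<Rightarrow> 'a) \<Rightarrow> bool" where
  "bounded_clinear T \<longleftrightarrow> bounded_linear T \<and> (\<forall>c x. T (c *\<^sub>C x) = c *\<^sub>C T x)"

definition invertible_op :: "('a::complex_banach \<Rightarrow> 'a) \<Rightarrow> bool" where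
  "invertible_op T \<longleftrightarrow> bounded_clinear T \<and>
     (\<exists>S. bounded_clinear S \<and> S \<circ> T = id \<and> T \<circ> S = id)"

definition op_spectrum :: "('a::complex_banach \<Rightarrow> 'a) \<Rightarrow> complex set" where
  "op_spectrum T = {l. \<not> invertible_op (\<lambda>x. l *\<^sub>C x - T x)}"

definition quasinilpotent :: "('a::complex_banach \<Rightarrow> 'a) \<Rightarrow> bool" where
  "quasinilpotent Q \<longleftrightarrow> bounded_clinear Q \<and> op_spectrum Q = {0}"

definition B_set :: "('a::complex_banach \<Rightarrow> 'a) \<Rightarrow> complex set" where
  "B_set Q = {z. bdd_above (range (\<lambda>j::nat. onorm ((\<lambda>x. x + z *\<^sub>C Q x) ^^ j)))}"

text \<open>
  Invertibility is demanded explicitly because \<open>inv\<close> is a total function; for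
  quasinilpotent \<open>Q\<close> it always holds.
\<close>

definition R_set :: "('a::complex_banach \<Rightarrow> 'a) \<Rightarrow> complex set" where
  "R_set Q = {z. (\<forall>s. Re s > - 1/2 \<longrightarrow> invertible_op (\<lambda>x. x - (s * z) *\<^sub>C Q x)) \<and>
     bdd_above ((\<lambda>s. onorm (inv (\<lambda>x. x - (s * z) *\<^sub>C Q x))) ` {s. Re s > - 1/2})}"

text \<open>The whole plane is an open sector in this sense.\<close>

definition sector :: "complex set \<Rightarrow> bool" where
  "sector S \<longleftrightarrow> convex S \<and> (\<forall>z\<in>S. \<forall>r>0. complex_of_real r * z \<in> S)"

definition balanced_sector :: "real \<Rightarrow> complex set" where
  "balanced_sector \<theta> = {complex_of_real r * cis t | r t. r > 0 \<and> t \<in> {-\<theta><..<\<theta>}}"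

end

theory Submission
  imports Defs
begin

text \<open>
  Write \<open>R w = (I - wQ)\<^sup>-\<^sup>1\<close> and \<open>H z = {w. Re (w * cnj z) \<ge> 0}\<close>, and let \<open>K\<close> be the set of all \<open>z\<close>
  such that \<open>R\<close> is bounded on the half-plane \<open>H z\<close>. For \<open>z \<noteq> 0\<close>, the condition \<open>z \<in> R_set Q\<close>
  is equivalent to \<open>z \<in> K\<close>, because bounds for \<open>R\<close> persist under perturbations of \<open>w\<close> that are small
  relative to \<open>\<bar>w\<bar>\<close>; for the same reason \<open>K - {0}\<close> is open. As \<open>H (z + z') \<subseteq> H z \<union> H z'\<close>, the set \<open>K\<close> is
  a convex cone, and \<open>0 \<notin> K\<close> unless \<open>R\<close> is bounded on the whole plane, that is, \<open>Q = 0\<close>.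

  If \<open>z \<in> K\<close>, then \<open>I + zQ\<close> is a Ritt operator and therefore power bounded, so \<open>K \<subseteq> B_set Q\<close>.
  Conversely, power boundedness of \<open>I + zQ\<close> bounds \<open>R\<close> on every proper closed subsector of \<open>H z\<close>; if
  \<open>z\<close> is an interior point of \<open>B_set Q\<close>, two such sectors for points close to \<open>z\<close> on either side of
  the ray through \<open>z\<close> cover \<open>H z\<close>. Hence \<open>K\<close> is the interior of \<open>B_set Q\<close>.

  All resolvent bounds are used in the form \<open>\<parallel>x\<parallel> \<le> M \<parallel>x - wQx\<parallel>\<close>, and averages over roots of unity
  take the place of contour integrals.
\<close>

section \<open>Bounded complex-linear operators\<close>

interpretation scaleC: vector_space "scaleC :: complex \<Rightarrow> 'a::complex_banach \<Rightarrow> 'a"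
  using scaleC_of_real[of 1]
  by unfold_locales (auto simp: scaleC_add_right scaleC_add_left scaleC_scaleC)

lemma bounded_clinearD:
  assumes "bounded_clinear T"
  shows "bounded_linear T" "T (c *\<^sub>C x) = c *\<^sub>C T x" "T (x + y) = T x + T y" "T (x - y) = T x - T y"
    "T 0 = 0" "T (sum f A) = (\<Sum>i\<in>A. T (f i))"
proof -
  show *: "bounded_linear T" and "T (c *\<^sub>C x) = c *\<^sub>C T x"
    using assms by (auto simp: bounded_clinear_def)
  interpret bounded_linear T by fact
  show "T (x + y) = T x + T y" "T (x - y) = T x - T y" "T 0 = 0"
    "T (sum f A) = (\<Sum>i\<in>A. T (f i))"
    by (rule add diff zero sum)+
qed

lemma bounded_linear_scaleC: "bounded_linear (\<lambda>x. c *\<^sub>C (x::'a::complex_banach))"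
proof (rule bounded_linear_intro[where K = "cmod c"])
  show "c *\<^sub>C (r *\<^sub>R x) = r *\<^sub>R c *\<^sub>C x" for r and x :: 'a
    by (simp add: scaleC_of_real[symmetric] scaleC_scaleC mult.commute)
qed (simp_all add: scaleC_add_right norm_scaleC)

lemma bounded_clinear_scaleC: "bounded_clinear (\<lambda>x. c *\<^sub>C x)"
  by (simp add: bounded_clinear_def bounded_linear_scaleC scaleC_scaleC mult.commute)

lemma bounded_clinear_id: "bounded_clinear (\<lambda>x. x)"
  by (simp add: bounded_clinear_def)

lemma bounded_clinear_add:
  "bounded_clinear S \<Longrightarrow> bounded_clinear T \<Longrightarrow> bounded_clinear (\<lambda>x. S x + T x)"
  by (simp add: bounded_clinear_def bounded_linear_add scaleC_add_right)

lemma bounded_clinear_diff: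
  "bounded_clinear S \<Longrightarrow> bounded_clinear T \<Longrightarrow> bounded_clinear (\<lambda>x. S x - T x)"
  by (simp add: bounded_clinear_def bounded_linear_sub scaleC.scale_right_diff_distrib)

lemma bounded_clinear_compose:
  "bounded_clinear S \<Longrightarrow> bounded_clinear T \<Longrightarrow> bounded_clinear (\<lambda>x. S (T x))"
  by (simp add: bounded_clinear_def bounded_linear_compose)

lemma bounded_clinear_funpow: "bounded_clinear T \<Longrightarrow> bounded_clinear (T ^^ n)"
proof (induction n)
  case 0
  then show ?case using bounded_clinear_id by (simp add: id_def)
next
  case (Suc n)
  then show ?case using bounded_clinear_compose[of T "T ^^ n"] by (simp add: o_def)
qed

lemma bounded_clinear_perturb_id:
  "bounded_clinear Q \<Longrightarrow> bounded_clinear (\<lambda>x. x + z *\<^sub>C Q x)"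
  by (intro bounded_clinear_add bounded_clinear_id bounded_clinear_compose[OF bounded_clinear_scaleC])

section \<open>Averages over roots of unity\<close>

definition root_of_unity :: "nat \<Rightarrow> complex" where
  "root_of_unity N = cis (2 * pi / N)"

lemma norm_root_of_unity_power [simp]: "cmod (root_of_unity N ^ k) = 1"
  by (simp add: root_of_unity_def norm_power)

lemma root_of_unity_power_self: "N > 0 \<Longrightarrow> root_of_unity N ^ N = 1"
  unfolding root_of_unity_def Complex.DeMoivre by simp

text \<open>All nodes of an average share one \<open>N\<close>-th power, so the remainder of a
  truncated Neumann series involves the same multiple of \<open>T ^^ N\<close> at every
  node.\<close>

lemma times_root_of_unity_power_self:
  assumes "N > 0"
  shows "(c * root_of_unity N ^ k) ^ N = c ^ N"
proof -
  have "(root_of_unity N ^ k) ^ N = (root_of_unity N ^ N) ^ k"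
    by (simp add: power_mult[symmetric] mult.commute)
  then show ?thesis using assms by (simp add: power_mult_distrib root_of_unity_power_self)
qed

text \<open>A discrete form of Cauchy's coefficient formula: averaging a polynomial over the nodes
  keeps exactly the exponents divisible by \<open>N\<close>.\<close>

lemma sum_root_of_unity_powers:
  assumes "N > 0"
  shows "(\<Sum>k<N. root_of_unity N ^ (k * m)) = (if N dvd m then of_nat N else 0)"
proof -
  let ?q = "root_of_unity N ^ m"
  have N: "root_of_unity N ^ N = 1"
    using assms by (rule root_of_unity_power_self)
  have q: "(\<Sum>k<N. root_of_unity N ^ (k * m)) = (\<Sum>k<N. ?q ^ k)"
    by (simp add: power_mult[symmetric] mult.commute)
  have one: "?q = 1 \<longleftrightarrow> N dvd m"
  proof
    assume "?q = 1"
    then have "cis (2 * pi * m / N) = 1"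
      by (simp add: root_of_unity_def Complex.DeMoivre mult.commute)
    then have "cos (2 * pi * m / N) = 1"
      by (metis cis.sel(1) one_complex.sel(1))
    then obtain j :: int where "2 * pi * m / N = real_of_int j * 2 * pi"
      unfolding cos_one_2pi_int by blast
    then have "real m = j * real N"
      using assms by (simp add: field_simps)
    then have "int m = j * int N"
      by (metis of_int_eq_iff of_int_mult of_int_of_nat_eq)
    then show "N dvd m"
      by (metis dvd_triv_right int_dvd_int_iff)
  next
    assume "N dvd m"
    then show "?q = 1"
      using N by (auto simp: power_mult)
  qed
  show ?thesis
  proof (cases "N dvd m")
    case True
    then show ?thesis using q one by simp
  next
    case False
    have "(\<Sum>k<N. ?q ^ k) = (?q ^ N - 1) / (?q - 1)"
      using False one by (intro geometric_sum) auto
    also have "?q ^ N = 1"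
      by (metis N mult.commute power_mult power_one)
    finally show ?thesis using q False by simp
  qed
qed

section \<open>Truncated Neumann series of \<open>I - uT\<close>\<close>

definition geom_op :: "('a::complex_banach \<Rightarrow> 'a) \<Rightarrow> nat \<Rightarrow> complex \<Rightarrow> 'a \<Rightarrow> 'a" where
  "geom_op T N u y = (\<Sum>j<N. u ^ j *\<^sub>C (T ^^ j) y)"

lemma bounded_clinear_geom_op:
  assumes "bounded_clinear T"
  shows "bounded_clinear (geom_op T N u)"
proof -
  have "bounded_linear (geom_op T N u)"
    unfolding geom_op_def
    by (intro bounded_linear_sum bounded_linear_compose[OF bounded_linear_scaleC]
        bounded_clinearD(1) bounded_clinear_funpow assms)
  then show ?thesis
    by (simp add: bounded_clinear_def geom_op_def scaleC.scale_sum_right scaleC_scaleC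
        bounded_clinearD(2)[OF bounded_clinear_funpow[OF assms]] mult.commute)
qed

text \<open>Being a polynomial in \<open>T\<close>, the truncated series is available whether or not
  \<open>I - uT\<close> has an inverse. A lower bound for \<open>I - uT\<close> turns this identity
  into a bound for \<open>geom_op\<close>.\<close>

lemma geom_op_telescope:
  assumes "bounded_clinear T"
  shows "geom_op T N u y - u *\<^sub>C T (geom_op T N u y) = y - u ^ N *\<^sub>C (T ^^ N) y"
proof (induction N)
  case 0
  then show ?case using bounded_clinearD(5)[OF assms] by (simp add: geom_op_def)
next
  case (Suc N)
  have "geom_op T (Suc N) u y = geom_op T N u y + u ^ N *\<^sub>C (T ^^ N) y"
    by (simp add: geom_op_def)
  then have "geom_op T (Suc N) u y - u *\<^sub>C T (geom_op T (Suc N) u y)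
      = (geom_op T N u y - u *\<^sub>C T (geom_op T N u y))
        + (u ^ N *\<^sub>C (T ^^ N) y - u *\<^sub>C T (u ^ N *\<^sub>C (T ^^ N) y))"
    by (simp add: bounded_clinearD(3)[OF assms] scaleC_add_right)
  then show ?case
    unfolding Suc.IH by (simp add: bounded_clinearD(2)[OF assms] scaleC_scaleC)
qed

lemma geom_op_commute:
  assumes "bounded_clinear T"
  shows "geom_op T N u (T y) = T (geom_op T N u y)"
  using assms by (simp add: geom_op_def bounded_clinearD funpow_swap1)

lemma geom_op_funpow_commute:
  assumes "bounded_clinear T"
  shows "(T ^^ m) (geom_op T N u y) = geom_op T N u ((T ^^ m) y)"
  by (induction m) (simp_all add: geom_op_commute[OF assms])

lemma geom_op_telescope':
  assumes "bounded_clinear T"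
  shows "geom_op T N u (y - u *\<^sub>C T y) = y - u ^ N *\<^sub>C (T ^^ N) y"
  using geom_op_telescope[OF assms, of N u y] geom_op_commute[OF assms, of N u y]
  by (simp add: bounded_clinearD[OF bounded_clinear_geom_op[OF assms]])

lemma sum_geom_op_roots:
  assumes "N > 0"
  shows "(\<Sum>k<N. geom_op T N (r * root_of_unity N ^ k) y) = of_nat N *\<^sub>C y"
proof -
  have "(\<Sum>k<N. geom_op T N (r * root_of_unity N ^ k) y)
      = (\<Sum>j<N. \<Sum>k<N. (r * root_of_unity N ^ k) ^ j *\<^sub>C (T ^^ j) y)"
    unfolding geom_op_def by (rule sum.swap)
  also have "\<dots> = (\<Sum>j<N. (r ^ j * (\<Sum>k<N. root_of_unity N ^ (k * j))) *\<^sub>C (T ^^ j) y)"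
    by (simp add: scaleC.scale_sum_left sum_distrib_left power_mult_distrib power_mult)
  also have "\<dots> = (\<Sum>j<N. if j = 0 then of_nat N *\<^sub>C y else 0)"
    using assms by (intro sum.cong) (auto simp: sum_root_of_unity_powers dest: dvd_imp_le)
  also have "\<dots> = of_nat N *\<^sub>C y"
    using assms by (simp add: sum.delta)
  finally show ?thesis .
qed

text \<open>The weight is the root of unity to the power \<open>-kn\<close>, written with a natural
  exponent, and selects the exponents congruent to \<open>n\<close> modulo \<open>N\<close>. In the
  square of the truncated series these are \<open>n\<close>, reached by \<open>n + 1\<close> index
  pairs, and \<open>n + N\<close>, reached by \<open>N - n - 1\<close> pairs.\<close>

lemma sum_geom_op_square_roots:
  assumes "bounded_clinear T" "n < N"
  shows "(\<Sum>k<N. root_of_unity N ^ (k * (N - n)) *\<^sub>C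
            geom_op T N (r * root_of_unity N ^ k) (geom_op T N (r * root_of_unity N ^ k) y))
    = of_nat N *\<^sub>C (of_nat (Suc n) *\<^sub>C r ^ n *\<^sub>C (T ^^ n) y
        + of_nat (N - Suc n) *\<^sub>C r ^ (n + N) *\<^sub>C (T ^^ (n + N)) y)"
proof -
  let ?w = "root_of_unity N"
  define V where "V m = r ^ m *\<^sub>C (T ^^ m) y" for m
  have N: "N > 0" using assms by simp
  \<comment> \<open>The number \<open>N - n + (i + j)\<close> lies strictly between 0 and
    \<open>3N\<close>, so only the multiples \<open>N\<close> and \<open>2N\<close> occur, and each
    \<open>i\<close> has exactly one partner \<open>j\<close>.\<close>
  have dvd: "N dvd N - n + (i + j) \<longleftrightarrow> j = (if i \<le> n then n - i else n + N - i)"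
    if ij: "i < N" "j < N" for i j
  proof
    assume "N dvd N - n + (i + j)"
    then obtain c where c: "N - n + (i + j) = N * c" by (auto elim: dvdE)
    have "N * c < N * 3" using c ij assms(2) by linarith
    moreover have "N * c > 0" using c assms(2) by linarith
    ultimately have "c = 1 \<or> c = 2" by auto
    then show "j = (if i \<le> n then n - i else n + N - i)"
      using c ij assms(2) by auto
  next
    assume "j = (if i \<le> n then n - i else n + N - i)"
    then have "N - n + (i + j) = N \<or> N - n + (i + j) = N * 2"
      using ij assms(2) by (auto split: if_splits)
    then show "N dvd N - n + (i + j)" by auto
  qed
  have "geom_op T N u (geom_op T N u y) = (\<Sum>i<N. \<Sum>j<N. u ^ (i + j) *\<^sub>C (T ^^ (i + j)) y)" for u
    by (simp add: geom_op_def bounded_clinearD[OF bounded_clinear_funpow[OF assms(1)]]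
        scaleC.scale_sum_right scaleC_scaleC power_add funpow_add)
  then have "(\<Sum>k<N. ?w ^ (k * (N - n)) *\<^sub>C geom_op T N (r * ?w ^ k) (geom_op T N (r * ?w ^ k) y))
    = (\<Sum>k<N. \<Sum>i<N. \<Sum>j<N. ?w ^ (k * (N - n + (i + j))) *\<^sub>C V (i + j))"
    by (simp add: V_def scaleC.scale_sum_right scaleC_scaleC power_mult_distrib
        power_mult[symmetric] power_add[symmetric] algebra_simps)
  also have "\<dots> = (\<Sum>i<N. \<Sum>k<N. \<Sum>j<N. ?w ^ (k * (N - n + (i + j))) *\<^sub>C V (i + j))"
    by (rule sum.swap)
  also have "\<dots> = (\<Sum>i<N. \<Sum>j<N. \<Sum>k<N. ?w ^ (k * (N - n + (i + j))) *\<^sub>C V (i + j))"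
    by (intro sum.cong refl sum.swap)
  also have "\<dots> = (\<Sum>i<N. \<Sum>j<N. (\<Sum>k<N. ?w ^ (k * (N - n + (i + j)))) *\<^sub>C V (i + j))"
    by (simp only: scaleC.scale_sum_left)
  also have "\<dots> = (\<Sum>i<N. \<Sum>j<N. if j = (if i \<le> n then n - i else n + N - i)
                     then of_nat N *\<^sub>C V (i + j) else 0)"
    using dvd by (intro sum.cong refl) (simp add: sum_root_of_unity_powers[OF N])
  also have "\<dots> = (\<Sum>i<N. of_nat N *\<^sub>C V (if i \<le> n then n else n + N))"
    using assms by (intro sum.cong refl) (auto simp: sum.delta)
  also have "\<dots> = of_nat N *\<^sub>C (\<Sum>i<N. V (if i \<le> n then n else n + N))"
    by (simp add: scaleC.scale_sum_right)
  also have "(\<Sum>i<N. V (if i \<le> n then n else n + N))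
      = (\<Sum>i<Suc n. V n) + (\<Sum>i\<in>{Suc n..<N}. V (n + N))"
  proof -
    have "{..<N} = {..<Suc n} \<union> {Suc n..<N}" using assms by auto
    then show ?thesis
      by (simp only: sum.union_disjoint[of "{..<Suc n}" "{Suc n..<N}"] finite_lessThan
          finite_atLeastLessThan ivl_disj_int) (auto intro!: arg_cong2[of _ _ _ _ "(+)"] sum.cong)
  qed
  also have "(\<Sum>i<Suc n. V n) = of_nat (Suc n) *\<^sub>C V n"
    by (simp only: scaleC.sum_constant_scale card_lessThan)
  also have "(\<Sum>i\<in>{Suc n..<N}. V (n + N)) = of_nat (N - Suc n) *\<^sub>C V (n + N)"
    by (simp only: scaleC.sum_constant_scale card_atLeastLessThan)
  finally show ?thesis by (simp add: V_def)
qed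

text \<open>Since \<open>u ^ N = r ^ N\<close> at every node, \<open>1 / (1 - u)\<close> is a finite
  geometric sum divided by \<open>1 - r ^ N\<close>, with mean \<open>1 / (1 - r ^ N)\<close>. On
  the circle of radius \<open>r\<close>, the inverse square of \<open>cmod (1 - u)\<close> is an
  affine function of \<open>Re (1 / (1 - u))\<close>; this is the Poisson kernel identity.\<close>

lemma sum_Poisson_roots:
  assumes "N > 0" "0 \<le> r" "r < 1"
  shows "(\<Sum>k<N. 1 / (cmod (1 - of_real r * root_of_unity N ^ k))\<^sup>2)
    = N * ((1 + r ^ N) / ((1 - r ^ N) * (1 - r\<^sup>2)))"
proof -
  define u where "u k = of_real r * root_of_unity N ^ k" for k
  have cu: "cmod (u k) = r" for k
    using assms by (simp add: u_def norm_mult)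
  then have u1: "u k \<noteq> 1" for k
    using assms by (metis norm_one less_irrefl)
  have rN: "r ^ N < 1" "r\<^sup>2 < 1"
    using assms by (simp_all add: power_less_one_iff)
  have uN: "u k ^ N = of_real (r ^ N)" for k
    using assms by (simp add: u_def times_root_of_unity_power_self)
  have "(\<Sum>k<N. 1 / (1 - u k)) = (\<Sum>k<N. (\<Sum>j<N. u k ^ j) / of_real (1 - r ^ N))"
  proof (intro sum.cong refl)
    fix k
    have "1 - of_real (r ^ N) \<noteq> (0::complex)" using rN
      by (metis eq_iff_diff_eq_0 less_irrefl of_real_eq_1_iff)
    moreover have "(\<Sum>j<N. u k ^ j) = (u k ^ N - 1) / (u k - 1)"
      using u1 by (rule geometric_sum)
    ultimately show "1 / (1 - u k) = (\<Sum>j<N. u k ^ j) / of_real (1 - r ^ N)"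
      using u1[of k] by (simp add: uN divide_simps) (simp add: algebra_simps)
  qed
  also have "\<dots> = (\<Sum>k<N. \<Sum>j<N. u k ^ j) / of_real (1 - r ^ N)"
    by (simp add: sum_divide_distrib)
  also have "(\<Sum>k<N. \<Sum>j<N. u k ^ j) = (\<Sum>j<N. \<Sum>k<N. u k ^ j)"
    by (rule sum.swap)
  also have "\<dots> = (\<Sum>j<N. of_real r ^ j * (\<Sum>k<N. root_of_unity N ^ (k * j)))"
    by (simp add: u_def sum_distrib_left power_mult_distrib power_mult)
  also have "\<dots> = (\<Sum>j<N. if j = 0 then of_nat N else 0)"
    using assms by (intro sum.cong) (auto simp: sum_root_of_unity_powers dest: dvd_imp_le)
  also have "\<dots> = of_nat N"
    using assms by (simp add: sum.delta)
  finally have S: "(\<Sum>k<N. Re (1 / (1 - u k))) = N / (1 - r ^ N)"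
    by (metis Re_complex_of_real Re_sum of_real_divide of_real_of_nat_eq)
  have "1 / (cmod (1 - u k))\<^sup>2 = (2 * Re (1 / (1 - u k)) - 1) / (1 - r\<^sup>2)" for k
  proof -
    have a: "(cmod (1 - u k))\<^sup>2 \<noteq> 0" using u1[of k] by simp
    have "(cmod (1 - u k))\<^sup>2 = 1 - 2 * Re (u k) + r\<^sup>2"
      unfolding cu[of k, symmetric] cmod_power2 by (simp add: power2_eq_square algebra_simps)
    moreover have "Re (1 / (1 - u k)) = (1 - Re (u k)) / (cmod (1 - u k))\<^sup>2"
      by (simp add: Re_divide cmod_power2)
    ultimately show ?thesis
      using a rN by (simp add: divide_simps) (simp add: algebra_simps)
  qed
  then have "(\<Sum>k<N. 1 / (cmod (1 - u k))\<^sup>2) = (2 * (\<Sum>k<N. Re (1 / (1 - u k))) - N) / (1 - r\<^sup>2)"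
    by (simp add: sum_divide_distrib[symmetric] sum_subtractf sum_distrib_left)
  also have "\<dots> = N * ((1 + r ^ N) / ((1 - r ^ N) * (1 - r\<^sup>2)))"
    using rN unfolding S by (simp add: divide_simps) (simp add: algebra_simps)
  finally show ?thesis by (simp only: u_def)
qed


section \<open>Power boundedness of Ritt operators\<close>

text \<open>
  Averaging the resolvent bound over \<open>N\<close> equidistant points \<open>u\<close> of a circle gives
  bounds for \<open>I - r\<^sup>N T\<^sup>N\<close> that are uniform in \<open>N\<close>. They let the radius \<open>r\<close> at which \<open>r\<^sup>N T\<^sup>N\<close>
  is eventually small grow in steps of fixed size.
\<close>

lemma eventually_power_small_step:
  fixes T :: "'a::complex_banach \<Rightarrow> 'a"
  assumes T: "bounded_clinear T"
    and K: "\<And>u x. cmod u \<le> r0 \<Longrightarrow> norm x \<le> K * norm (x - u *\<^sub>C T x)"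
    and small: "\<And>y. norm (of_real r' ^ N *\<^sub>C (T ^^ N) y) \<le> norm y / 4"
    and r: "0 \<le> r'" "r' < r" "r \<le> r0" "(r - r') * (onorm T * K\<^sup>2) \<le> 1 / 5" and N: "N > 0"
  shows "norm (of_real r ^ N *\<^sub>C (T ^^ N) y) \<le> norm y"
proof -
  note lin = bounded_clinearD[OF T]
  note plin = bounded_clinearD[OF bounded_clinear_geom_op[OF T]]
  define a where "a = of_real r ^ N *\<^sub>C (T ^^ N) y"
  define b where "b = of_real r' ^ N *\<^sub>C (T ^^ N) y"
  define u where "u k = of_real r * root_of_unity N ^ k" for k
  define v where "v k = of_real r' * root_of_unity N ^ k" for k
  have TN: "bounded_clinear (T ^^ N)" by (rule bounded_clinear_funpow[OF T])
  have cu: "cmod (u k) \<le> r0" "cmod (v k) \<le> r0" "cmod (u k - v k) = r - r'" for k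
    using r by (simp_all add: u_def v_def norm_mult left_diff_distrib[symmetric]
        of_real_diff[symmetric] del: of_real_diff)
  have uN: "u k ^ N = of_real r ^ N" "v k ^ N = of_real r' ^ N" for k
    using N by (simp_all add: u_def v_def times_root_of_unity_power_self)
  have K0: "norm (geom_op T N w x) \<le> K * norm (x - w ^ N *\<^sub>C (T ^^ N) x)" if "cmod w \<le> r0" for w x
    using K[OF that, of "geom_op T N w x"] by (simp add: geom_op_telescope[OF T])
  show ?thesis
  proof (cases "y = 0")
    case True
    then show ?thesis using bounded_clinearD[OF TN] by simp
  next
    case False
    moreover have "norm y \<le> K * norm y" using K[of 0 y] r by simp
    ultimately have K_nonneg: "K \<ge> 0" by simp
    \<comment> \<open>The commuting operators \<open>I - r^N T^N\<close> and
      \<open>I - r'^N T^N\<close> are both applied to \<open>y\<close>, so \<open>z\<close> can be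
      read in either order.\<close>
    define z where "z = (y - b) - of_real r ^ N *\<^sub>C (T ^^ N) (y - b)"
    have z: "z = (y - a) - of_real r' ^ N *\<^sub>C (T ^^ N) (y - a)"
      by (simp add: z_def a_def b_def bounded_clinearD[OF TN] scaleC_scaleC
          scaleC.scale_right_diff_distrib mult.commute)
    have pp: "norm (u k *\<^sub>C T (geom_op T N (u k) (geom_op T N (v k) y))
                  - v k *\<^sub>C T (geom_op T N (u k) (geom_op T N (v k) y)))
        \<le> (r - r') * (onorm T * K\<^sup>2) * norm z" for k
    proof -
      let ?g = "geom_op T N (u k) (geom_op T N (v k) y)"
      have "norm ?g \<le> K * norm (geom_op T N (v k) y - u k ^ N *\<^sub>C (T ^^ N) (geom_op T N (v k) y))"
        by (rule K0[OF cu(1)])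
      also have "geom_op T N (v k) y - u k ^ N *\<^sub>C (T ^^ N) (geom_op T N (v k) y)
          = geom_op T N (v k) (y - a)"
        by (simp add: a_def uN plin geom_op_funpow_commute[OF T])
      also have "norm \<dots> \<le> K * norm z"
        using K0[OF cu(2), of k "y - a"] by (simp add: z uN)
      finally have g: "norm ?g \<le> K * (K * norm z)"
        using K_nonneg by (simp add: mult_left_mono)
      have "norm ((u k - v k) *\<^sub>C T ?g) = (r - r') * norm (T ?g)"
        by (simp add: norm_scaleC cu)
      also have "\<dots> \<le> (r - r') * (onorm T * norm ?g)"
        using r onorm[OF lin(1)] by (intro mult_left_mono) auto
      also have "\<dots> \<le> (r - r') * (onorm T * (K * (K * norm z)))"
        using r g onorm_pos_le[OF lin(1)] by (intro mult_left_mono) auto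
      finally show ?thesis
        by (simp add: scaleC.scale_left_diff_distrib power2_eq_square mult_ac)
    qed
    \<comment> \<open>A discrete resolvent identity: \<open>(I - vT) - (I - uT) = (u - v)T\<close>,
      applied to the product of the two truncated series. Averaging over \<open>k\<close> then
      leaves only \<open>a - b\<close>.\<close>
    have diff: "u k *\<^sub>C T (geom_op T N (u k) (geom_op T N (v k) y))
                  - v k *\<^sub>C T (geom_op T N (u k) (geom_op T N (v k) y))
        = geom_op T N (u k) (y - b) - geom_op T N (v k) (y - a)" for k
    proof -
      let ?g = "geom_op T N (u k) (geom_op T N (v k) y)"
      have 1: "?g - u k *\<^sub>C T ?g = geom_op T N (v k) (y - a)"
        using geom_op_telescope[OF T, of N "u k" "geom_op T N (v k) y"]
        by (simp add: a_def uN plin geom_op_funpow_commute[OF T])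
      have "?g - v k *\<^sub>C T ?g
          = geom_op T N (u k) (geom_op T N (v k) y - v k *\<^sub>C T (geom_op T N (v k) y))"
        by (simp add: plin geom_op_commute[OF T])
      then have 2: "?g - v k *\<^sub>C T ?g = geom_op T N (u k) (y - b)"
        by (simp add: geom_op_telescope[OF T] b_def uN)
      from 1 2 show ?thesis by (simp add: algebra_simps)
    qed
    have "of_nat N *\<^sub>C (a - b) = (\<Sum>k<N. geom_op T N (u k) (y - b) - geom_op T N (v k) (y - a))"
      using sum_geom_op_roots[OF N, of T "of_real r" "y - b"]
        sum_geom_op_roots[OF N, of T "of_real r'" "y - a"]
      by (simp add: sum_subtractf u_def v_def scaleC.scale_right_diff_distrib)
    then have "norm (of_nat N *\<^sub>C (a - b)) \<le> N * ((r - r') * (onorm T * K\<^sup>2) * norm z)"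
      using pp sum_norm_bound[of "{..<N}" "\<lambda>k. geom_op T N (u k) (y - b) - geom_op T N (v k) (y - a)"
          "(r - r') * (onorm T * K\<^sup>2) * norm z"] by (simp add: diff)
    then have "norm (a - b) \<le> (r - r') * (onorm T * K\<^sup>2) * norm z"
      using N by (simp add: norm_scaleC)
    also have "\<dots> \<le> 1 / 5 * norm z"
      using r by (intro mult_right_mono) auto
    finally have "norm (a - b) \<le> 1 / 5 * norm z" .
    \<comment> \<open>The constants close the estimate: 1/5 times 5/4 is 1/4, so
      \<open>norm a\<close> is at most \<open>(norm y + norm a) / 4 + norm y / 4\<close>, hence at
      most two thirds of \<open>norm y\<close>.\<close>
    moreover have "norm z \<le> norm (y - a) + norm (y - a) / 4"
      unfolding z using small[of "y - a"] by (smt (verit) norm_triangle_ineq4)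
    moreover have "norm (y - a) \<le> norm y + norm a" by (rule norm_triangle_ineq4)
    moreover have "norm b \<le> norm y / 4" using small[of y] by (simp add: b_def)
    moreover have "norm a \<le> norm (a - b) + norm b" by (metis diff_add_cancel norm_triangle_ineq)
    ultimately show ?thesis unfolding a_def[symmetric] using norm_ge_zero[of y] by linarith
  qed
qed

text \<open>A substitute for the spectral radius formula. The radius climbs through the multiples of
  a fixed width \<open>d\<close>; each stage jumps two widths ahead and falls back by one to restore
  the constant 1/4.\<close>

lemma eventually_power_small:
  fixes T :: "'a::complex_banach \<Rightarrow> 'a"
  assumes T: "bounded_clinear T"
    and K: "\<And>u x. cmod u \<le> r0 \<Longrightarrow> norm x \<le> K * norm (x - u *\<^sub>C T x)"
    and r: "0 \<le> r" "r < r0"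
  shows "\<forall>\<^sub>F N in sequentially. \<forall>y. norm (of_real r ^ N *\<^sub>C (T ^^ N) y) \<le> norm y / 4"
proof -
  define L where "L = onorm T * K\<^sup>2"
  have L: "L \<ge> 0" using onorm_pos_le[OF bounded_clinearD(1)[OF T]] by (simp add: L_def)
  \<comment> \<open>This makes \<open>d\<close> small enough that a jump of width \<open>2d\<close>
    meets the 1/5 condition of \<open>eventually_power_small_step\<close> and that \<open>r\<close>
    lies at least one width below \<open>r0\<close>.\<close>
  obtain m :: nat where m: "10 * L * r0 + r0 / (r0 - r) + 1 < m" using reals_Archimedean2 by blast
  define d where "d = r0 / m"
  have quot: "r0 / (r0 - r) \<ge> 0" "L * r0 \<ge> 0" using r L by auto
  then have "real m > 0" using m by linarith
  then have m0: "m > 0" "real m > 0" by simp_all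
  have d: "d > 0" using m0 r by (simp add: d_def)
  have dL: "2 * d * L \<le> 1 / 5"
  proof -
    have "10 * L * r0 \<le> m" using m quot by linarith
    then show ?thesis using m0 by (simp add: d_def field_simps)
  qed
  have dr: "r \<le> r0 - d"
  proof -
    have "r0 / (r0 - r) < m" using m quot by linarith
    then have "r0 / m \<le> r0 - r" using m0 r by (simp add: field_simps)
    then show ?thesis by (simp add: d_def)
  qed
  have "\<forall>\<^sub>F N in sequentially. \<forall>y. norm (of_real (k * d) ^ N *\<^sub>C (T ^^ N) y) \<le> norm y / 4"
    if "Suc k \<le> m" for k
    using that
  proof (induction k)
    case 0
    show ?case
      using eventually_gt_at_top[of 0] by eventually_elim (simp add: power_0_left)
  next
    case (Suc k)
    \<comment> \<open>The jump from \<open>k * d\<close> to \<open>(k + 2) * d\<close> yields only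
      the constant 1. Back at \<open>(k + 1) * d\<close> the factor \<open>q ^ N\<close> is gained,
      which is eventually below 1/4.\<close>
    define q where "q = real (Suc k) / real (Suc (Suc k))"
    have q: "0 \<le> q" "q < 1" by (simp_all add: q_def)
    then have "(\<lambda>N. q ^ N) \<longlonglongrightarrow> 0" by (intro LIMSEQ_realpow_zero) auto
    then have "\<forall>\<^sub>F N in sequentially. q ^ N < 1 / 4"
      by (rule order_tendstoD) simp
    moreover have "\<forall>\<^sub>F N in sequentially. \<forall>y. norm (of_real (k * d) ^ N *\<^sub>C (T ^^ N) y) \<le> norm y / 4"
      using Suc by simp
    ultimately show ?case
      using eventually_gt_at_top[of 0]
    proof eventually_elim
      case (elim N)
      have le: "real (Suc (Suc k)) * d \<le> r0"
      proof -
        have "real (Suc (Suc k)) * d \<le> real m * d"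
          using Suc.prems d by (intro mult_right_mono) auto
        then show ?thesis using m0 by (simp add: d_def)
      qed
      show ?case
      proof
        fix y
        have "norm (of_real (real (Suc (Suc k)) * d) ^ N *\<^sub>C (T ^^ N) y) \<le> norm y"
        proof (rule eventually_power_small_step[OF T K, of r0])
          show "norm (of_real (real k * d) ^ N *\<^sub>C (T ^^ N) y) \<le> norm y / 4" for y
            using elim by blast
          show "(real (Suc (Suc k)) * d - real k * d) * (onorm T * K\<^sup>2) \<le> 1 / 5"
            using dL by (simp add: L_def algebra_simps)
        qed (use d le elim in \<open>auto simp: algebra_simps\<close>)
        moreover have "real (Suc k) * d = q * (real (Suc (Suc k)) * d)"
          by (simp add: q_def field_simps)
        then have "(of_real (real (Suc k) * d) :: complex) = of_real q * of_real (real (Suc (Suc k)) * d)"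
          by (simp only: of_real_mult)
        then have "norm (of_real (real (Suc k) * d) ^ N *\<^sub>C (T ^^ N) y)
            = q ^ N * norm (of_real (real (Suc (Suc k)) * d) ^ N *\<^sub>C (T ^^ N) y)"
          using q by (simp only: power_mult_distrib norm_scaleC norm_mult norm_power norm_of_real
              mult.assoc abs_of_nonneg)
        moreover have "q ^ N * norm (of_real (real (Suc (Suc k)) * d) ^ N *\<^sub>C (T ^^ N) y)
            \<le> 1 / 4 * norm y"
          using elim q calculation(1) by (intro mult_mono) auto
        ultimately show "norm (of_real (real (Suc k) * d) ^ N *\<^sub>C (T ^^ N) y) \<le> norm y / 4"
          by simp
      qed
    qed
  qed
  from this[of "m - 1"] have ev: "\<forall>\<^sub>F N in sequentially.
      \<forall>y. norm (of_real (real (m - 1) * d) ^ N *\<^sub>C (T ^^ N) y) \<le> norm y / 4"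
    using m0 by simp
  have rd: "r \<le> real (m - 1) * d"
    using m0 dr by (simp add: d_def of_nat_diff field_simps)
  show ?thesis
    using ev
  proof eventually_elim
    case (elim N)
    show ?case
    proof
      fix y
      have "norm (of_real r ^ N *\<^sub>C (T ^^ N) y) = r ^ N * norm ((T ^^ N) y)"
        using r by (simp add: norm_scaleC norm_power)
      also have "\<dots> \<le> (real (m - 1) * d) ^ N * norm ((T ^^ N) y)"
        using r rd by (intro mult_right_mono power_mono) auto
      also have "\<dots> = norm (of_real (real (m - 1) * d) ^ N *\<^sub>C (T ^^ N) y)"
        using d by (simp add: norm_scaleC norm_power norm_mult power_mult_distrib)
      finally show "norm (of_real r ^ N *\<^sub>C (T ^^ N) y) \<le> norm y / 4"
        using elim[rule_format, of y] by simp
    qed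
  qed
qed

text \<open>An intermediate radius gains a geometric factor, which outweighs \<open>N\<close>. This
  disposes of the error terms when the number of nodes tends to infinity.\<close>

lemma power_tendsto_zero:
  fixes T :: "'a::complex_banach \<Rightarrow> 'a"
  assumes T: "bounded_clinear T"
    and K: "\<And>u x. cmod u \<le> r0 \<Longrightarrow> norm x \<le> K * norm (x - u *\<^sub>C T x)"
    and r: "0 \<le> r" "r < r0"
  shows "(\<lambda>N. real N * (r ^ N * norm ((T ^^ N) y))) \<longlonglongrightarrow> 0"
proof -
  define r1 where "r1 = (r + r0) / 2"
  have r1: "r < r1" "r1 < r0" "0 < r1" using r by (auto simp: r1_def)
  define q where "q = r / r1"
  have q: "0 \<le> q" "q < 1" using r r1 by (auto simp: q_def)
  have small: "\<forall>\<^sub>F N in sequentially. \<forall>y. norm (of_real r1 ^ N *\<^sub>C (T ^^ N) y) \<le> norm y / 4"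
    by (rule eventually_power_small[OF T, of r0 K r1]) (use K r1 in auto)
  have ev: "\<forall>\<^sub>F N in sequentially. norm (real N * (r ^ N * norm ((T ^^ N) y))) \<le> real N * q ^ N * norm y"
    using small
  proof eventually_elim
    case (elim N)
    have "norm (of_real r1 ^ N *\<^sub>C (T ^^ N) y) \<le> norm y / 4" using elim by blast
    then have e: "r1 ^ N * norm ((T ^^ N) y) \<le> norm y"
      using r1 by (simp add: norm_scaleC norm_power) (smt (verit) norm_ge_zero)
    have "r ^ N * norm ((T ^^ N) y) = q ^ N * (r1 ^ N * norm ((T ^^ N) y))"
      using r1 by (simp add: q_def power_divide)
    also have "\<dots> \<le> q ^ N * norm y"
      using e q by (intro mult_left_mono) auto
    finally show ?case
      using r by (simp add: mult.assoc mult_left_mono)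
  qed
  have "(\<lambda>N. real N * q ^ N * norm y) \<longlonglongrightarrow> 0 * norm y"
    using powser_times_n_limit_0[of q] q by (intro tendsto_intros) auto
  then show ?thesis
    using Lim_null_comparison[OF ev] by simp
qed

text \<open>
  The squared resolvent is what makes the bound uniform: the \<open>n\<close>-th coefficient of
  \<open>(I - uT)\<^sup>-\<^sup>2\<close> is \<open>(n + 1) T\<^sup>n\<close>, while the mean of \<open>\<bar>1 - u\<bar>\<^sup>-\<^sup>2\<close> over the circle of
  radius \<open>r\<close> is only \<open>1 / (1 - r\<^sup>2)\<close>, which is of order \<open>n\<close> for \<open>r = (n + 1) / (n + 2)\<close>.
\<close>

lemma Ritt_power_bound_radius:
  fixes T :: "'a::complex_banach \<Rightarrow> 'a"
  assumes T: "bounded_clinear T"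
    and M: "\<And>u x. cmod u < 1 \<Longrightarrow> cmod (1 - u) * norm x \<le> M * norm (x - u *\<^sub>C T x)"
    and r: "0 \<le> r" "r < 1"
  shows "Suc n * (r ^ n * norm ((T ^^ n) y)) \<le> M\<^sup>2 / (1 - r\<^sup>2) * norm y"
proof (cases "y = 0")
  case True
  then show ?thesis using bounded_clinearD(5)[OF bounded_clinear_funpow[OF T]] by simp
next
  case False
  moreover have "norm y \<le> M * norm y" using M[of 0 y] by simp
  ultimately have M1: "M \<ge> 1" by simp
  \<comment> \<open>On the disc of radius \<open>r0\<close> the factor \<open>cmod (1 - u)\<close>
    is at least \<open>1 - r0\<close>, so the hypothesis becomes a uniform resolvent bound
    there.\<close>
  define r0 where "r0 = (1 + r) / 2"
  have r0: "r < r0" "r0 < 1" using r by (auto simp: r0_def)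
  have K: "norm x \<le> M / (1 - r0) * norm (x - u *\<^sub>C T x)" if "cmod u \<le> r0" for u x
  proof -
    have "1 - r0 \<le> cmod (1 - u)"
      using that norm_triangle_ineq2[of 1 u] by simp
    then have "(1 - r0) * norm x \<le> cmod (1 - u) * norm x" by (rule mult_right_mono) simp
    also have "\<dots> \<le> M * norm (x - u *\<^sub>C T x)" using that r0 by (intro M) simp
    finally show ?thesis using r0 by (simp add: field_simps)
  qed
  have lim: "(\<lambda>N. real N * (r ^ N * norm ((T ^^ N) x))) \<longlonglongrightarrow> 0" for x
    by (rule power_tendsto_zero[OF T, of r0 "M / (1 - r0)"]) (use K r r0 in auto)
  define A where "A N = of_real r ^ N *\<^sub>C (T ^^ N) y" for N
  have nA: "norm (A N) = r ^ N * norm ((T ^^ N) y)" for N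
    using r by (simp add: A_def norm_scaleC norm_power)
  define P where "P N = (1 + r ^ N) / ((1 - r ^ N) * (1 - r\<^sup>2))" for N
  \<comment> \<open>This is \<open>I - r^N T^N\<close> applied twice to \<open>y\<close>, the
    remainder after telescoping both factors of the squared series. It tends to
    \<open>y\<close>.\<close>
  define z where "z N = (y - A N) - (A N - A (N + N))" for N
  \<comment> \<open>The coefficient estimate before the limit; the last summand bounds the aliasing
    term with exponent \<open>n + N\<close>.\<close>
  have est: "Suc n * norm (A n) \<le> M\<^sup>2 * P N * norm (z N) + (N + n) * norm (A (N + n))"
    if N: "N > n" for N
  proof -
    define u where "u k = of_real r * root_of_unity N ^ k" for k
    have cu: "cmod (u k) = r" for k using r by (simp add: u_def norm_mult)
    have uN: "u k ^ N = of_real r ^ N" for k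
      using N by (simp add: u_def times_root_of_unity_power_self)
    have g: "cmod (1 - u k) * norm (geom_op T N (u k) x)
        \<le> M * norm (x - of_real r ^ N *\<^sub>C (T ^^ N) x)" for k x
      using M[of "u k" "geom_op T N (u k) x"] cu[of k] r
      by (simp add: geom_op_telescope[OF T] uN)
    have gg: "norm (geom_op T N (u k) (geom_op T N (u k) y))
        \<le> M\<^sup>2 * norm (z N) * (1 / (cmod (1 - u k))\<^sup>2)" for k
    proof -
      let ?g = "geom_op T N (u k)"
      have pos: "cmod (1 - u k) > 0" using cu[of k] r by auto
      have *: "?g y - of_real r ^ N *\<^sub>C (T ^^ N) (?g y) = ?g (y - A N)"
        by (simp add: A_def bounded_clinearD[OF bounded_clinear_geom_op[OF T]]
            geom_op_funpow_commute[OF T])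
      have "of_real r ^ N *\<^sub>C (T ^^ N) (y - A N) = A N - A (N + N)"
        by (simp add: A_def bounded_clinearD[OF bounded_clinear_funpow[OF T]] scaleC_scaleC
            power_add funpow_add scaleC.scale_right_diff_distrib)
      then have "cmod (1 - u k) * norm (?g (y - A N)) \<le> M * norm (z N)"
        using g[of k "y - A N"] by (simp add: z_def)
      then have "M * (cmod (1 - u k) * norm (?g (y - A N))) \<le> M * (M * norm (z N))"
        using M1 by (intro mult_left_mono) auto
      moreover have "cmod (1 - u k) * (cmod (1 - u k) * norm (?g (?g y)))
          \<le> cmod (1 - u k) * (M * norm (?g (y - A N)))"
        using g[of k "?g y"] by (intro mult_left_mono) (auto simp: *)
      ultimately have "(cmod (1 - u k))\<^sup>2 * norm (?g (?g y)) \<le> M\<^sup>2 * norm (z N)"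
        by (simp add: power2_eq_square mult_ac)
      then show ?thesis using pos by (simp add: field_simps)
    qed
    have "norm (\<Sum>k<N. root_of_unity N ^ (k * (N - n)) *\<^sub>C
            geom_op T N (u k) (geom_op T N (u k) y))
        \<le> (\<Sum>k<N. M\<^sup>2 * norm (z N) * (1 / (cmod (1 - u k))\<^sup>2))"
      by (rule sum_norm_le) (use gg in \<open>simp add: norm_scaleC\<close>)
    also have "\<dots> = M\<^sup>2 * norm (z N) * (N * P N)"
      using sum_Poisson_roots[of N r] N r
      by (simp add: sum_distrib_left[symmetric] u_def P_def del: times_divide_eq_right)
    also have "(\<Sum>k<N. root_of_unity N ^ (k * (N - n)) *\<^sub>C
            geom_op T N (u k) (geom_op T N (u k) y))
        = of_nat N *\<^sub>C (of_nat (Suc n) *\<^sub>C A n + of_nat (N - Suc n) *\<^sub>C A (n + N))"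
      unfolding u_def A_def by (rule sum_geom_op_square_roots[OF T N])
    finally have "N * norm (of_nat (Suc n) *\<^sub>C A n + of_nat (N - Suc n) *\<^sub>C A (n + N))
        \<le> N * (M\<^sup>2 * P N * norm (z N))"
      by (simp only: norm_scaleC norm_of_nat mult_ac)
    then have "norm (of_nat (Suc n) *\<^sub>C A n + of_nat (N - Suc n) *\<^sub>C A (n + N))
        \<le> M\<^sup>2 * P N * norm (z N)"
      using N by simp
    moreover have "norm (of_nat (Suc n) *\<^sub>C A n) \<le>
        norm (of_nat (Suc n) *\<^sub>C A n + of_nat (N - Suc n) *\<^sub>C A (n + N))
        + norm (of_nat (N - Suc n) *\<^sub>C A (n + N))"
      by (metis add_diff_cancel_right' norm_triangle_ineq4)
    moreover have "norm (of_nat (N - Suc n) *\<^sub>C A (n + N)) \<le> (N + n) * norm (A (N + n))"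
      by (auto simp: norm_scaleC add.commute[of n N] simp del: of_nat_diff intro!: mult_right_mono)
    ultimately show ?thesis by (simp add: norm_scaleC del: of_nat_Suc)
  qed
  have rlim: "(\<lambda>N. r ^ N) \<longlonglongrightarrow> 0" using r by (intro LIMSEQ_realpow_zero) auto
  have "(\<lambda>N. real N * norm (A N)) \<longlonglongrightarrow> 0"
    unfolding nA by (rule lim)
  then have A1: "(\<lambda>N. real (N + n) * norm (A (N + n))) \<longlonglongrightarrow> 0"
    by (rule LIMSEQ_ignore_initial_segment)
  have "\<forall>\<^sub>F N in sequentially. norm (A N) \<le> real N * norm (A N)"
    using eventually_gt_at_top[of 0] by eventually_elim (simp add: mult_le_cancel_right1)
  then have A0: "A \<longlonglongrightarrow> 0"
    by (rule Lim_null_comparison) fact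
  have "filterlim (\<lambda>N::nat. N + N) sequentially sequentially"
    by (rule filterlim_subseq) (simp add: strict_mono_def)
  from filterlim_compose[OF A0 this] have A2: "(\<lambda>N. A (N + N)) \<longlonglongrightarrow> 0" .
  have "z \<longlonglongrightarrow> (y - 0) - (0 - 0)"
    unfolding z_def by (intro tendsto_intros A0 A2)
  moreover have "P \<longlonglongrightarrow> (1 + 0) / ((1 - 0) * (1 - r\<^sup>2))"
  proof -
    have "r\<^sup>2 \<noteq> 1" using r by (simp add: power2_eq_1_iff)
    then show ?thesis unfolding P_def by (intro tendsto_intros rlim) auto
  qed
  ultimately have "(\<lambda>N. M\<^sup>2 * P N * norm (z N) + (N + n) * norm (A (N + n)))
      \<longlonglongrightarrow> M\<^sup>2 * ((1 + 0) / ((1 - 0) * (1 - r\<^sup>2))) * norm ((y - 0) - (0 - 0)) + 0"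
    using A1 by (intro tendsto_intros) auto
  moreover have "\<forall>\<^sub>F N in sequentially.
      Suc n * norm (A n) \<le> M\<^sup>2 * P N * norm (z N) + (N + n) * norm (A (N + n))"
    using eventually_gt_at_top[of n] by eventually_elim (rule est)
  ultimately have "Suc n * norm (A n)
      \<le> M\<^sup>2 * ((1 + 0) / ((1 - 0) * (1 - r\<^sup>2))) * norm ((y - 0) - (0 - 0)) + 0"
    by (intro tendsto_lowerbound) auto
  then show ?thesis by (simp add: nA)
qed

text \<open>The hypothesis is Ritt's resolvent condition at the point \<open>1 / u\<close>, in
  lower-bound form. With \<open>m = n + 1\<close> and \<open>r = m / (m + 1)\<close>, the loss from
  \<open>r ^ n\<close> is at most the factor \<open>exp 1\<close>, while
  \<open>1 / (1 - r\<^sup>2)\<close> is at most \<open>2 * m\<close> and cancels the factor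
  \<open>n + 1\<close>.\<close>

lemma Ritt_power_bounded:
  fixes T :: "'a::complex_banach \<Rightarrow> 'a"
  assumes T: "bounded_clinear T"
    and M: "\<And>u x. cmod u < 1 \<Longrightarrow> cmod (1 - u) * norm x \<le> M * norm (x - u *\<^sub>C T x)"
  shows "norm ((T ^^ n) y) \<le> 2 * exp 1 * M\<^sup>2 * norm y"
proof -
  define m where "m = real n + 1"
  have m: "m \<ge> 1" by (simp add: m_def)
  define r where "r = m / (m + 1)"
  have r: "0 < r" "r < 1" using m by (auto simp: r_def)
  have "r\<^sup>2 \<le> r" using r by (simp add: power2_eq_square mult_le_cancel_left1)
  then have "1 / (1 - r\<^sup>2) \<le> 1 / (1 - r)" using r by (intro divide_left_mono) auto
  also have "1 / (1 - r) = m + 1" using m by (simp add: r_def field_simps)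
  finally have q: "1 / (1 - r\<^sup>2) \<le> 2 * m" using m by simp
  have "(1 / r) ^ n \<le> exp 1"
  proof -
    have "1 / r = 1 + 1 / m" using m by (simp add: r_def field_simps)
    also have "\<dots> \<le> exp (1 / m)" by (rule exp_ge_add_one_self)
    finally have "(1 / r) ^ n \<le> exp (1 / m) ^ n" using r by (intro power_mono) auto
    also have "\<dots> = exp (n / m)" by (simp add: exp_of_nat_mult[symmetric])
    also have "\<dots> \<le> exp 1" by (simp add: m_def)
    finally show ?thesis .
  qed
  then have rn: "1 \<le> exp 1 * r ^ n"
    using r by (simp add: power_divide field_simps)
  have "m * norm ((T ^^ n) y) \<le> m * norm ((T ^^ n) y) * (exp 1 * r ^ n)"
    using mult_left_mono[OF rn, of "m * norm ((T ^^ n) y)"] m by simp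
  also have "\<dots> = exp 1 * (Suc n * (r ^ n * norm ((T ^^ n) y)))"
    by (simp add: m_def algebra_simps)
  also have "\<dots> \<le> exp 1 * (M\<^sup>2 / (1 - r\<^sup>2) * norm y)"
    using Ritt_power_bound_radius[OF T M, of r n y] r by (intro mult_left_mono) auto
  also have "\<dots> = exp 1 * (M\<^sup>2 * norm y) * (1 / (1 - r\<^sup>2))" by simp
  also have "\<dots> \<le> exp 1 * (M\<^sup>2 * norm y) * (2 * m)" using q by (intro mult_left_mono) auto
  finally have "m * norm ((T ^^ n) y) \<le> m * (2 * exp 1 * M\<^sup>2 * norm y)" by (simp add: mult_ac)
  then show ?thesis using m by simp
qed

section \<open>Half-planes on which the resolvent is bounded\<close>

text \<open>
  For bijective \<open>I - wQ\<close> this says that \<open>\<parallel>(I - wQ)\<^sup>-\<^sup>1\<parallel>\<close> is bounded over \<open>w \<in> S\<close>.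
\<close>

definition resolvent_bdd_on :: "('a::complex_banach \<Rightarrow> 'a) \<Rightarrow> complex set \<Rightarrow> bool" where
  "resolvent_bdd_on Q S \<longleftrightarrow> (\<exists>M. \<forall>w\<in>S. \<forall>x. norm x \<le> M * norm (x - w *\<^sub>C Q x))"

text \<open>The closed half-plane with inner normal \<open>z\<close>; for \<open>z = 0\<close> it
  degenerates to the whole plane.\<close>

definition half_plane :: "complex \<Rightarrow> complex set" where
  "half_plane z = {w. 0 \<le> Re (w * cnj z)}"

lemma resolvent_bdd_onE:
  assumes "resolvent_bdd_on Q S"
  obtains M where "M \<ge> 1" "\<And>w x. w \<in> S \<Longrightarrow> norm x \<le> M * norm (x - w *\<^sub>C Q x)"
proof -
  obtain M where M: "\<And>w x. w \<in> S \<Longrightarrow> norm x \<le> M * norm (x - w *\<^sub>C Q x)"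
    using assms by (auto simp: resolvent_bdd_on_def)
  have "norm x \<le> max 1 M * norm (x - w *\<^sub>C Q x)" if "w \<in> S" for w x
    using M[OF that, of x] by (rule order_trans) (simp add: mult_right_mono)
  then show ?thesis using that[of "max 1 M"] by simp
qed

lemma resolvent_bdd_on_Un:
  assumes "resolvent_bdd_on Q S" "resolvent_bdd_on Q S'"
  shows "resolvent_bdd_on Q (S \<union> S')"
proof -
  obtain M where M: "\<And>w x. w \<in> S \<Longrightarrow> norm x \<le> M * norm (x - w *\<^sub>C Q x)"
    using assms(1) unfolding resolvent_bdd_on_def by blast
  obtain M' where M': "\<And>w x. w \<in> S' \<Longrightarrow> norm x \<le> M' * norm (x - w *\<^sub>C Q x)"
    using assms(2) unfolding resolvent_bdd_on_def by blast
  have "norm x \<le> max M M' * norm (x - w *\<^sub>C Q x)" if "w \<in> S \<union> S'" for w x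
  proof (cases "w \<in> S")
    case True
    show ?thesis using M[OF True, of x] by (rule order_trans) (simp add: mult_right_mono)
  next
    case False
    then have "w \<in> S'" using that by blast
    from M'[OF this, of x] show ?thesis by (rule order_trans) (simp add: mult_right_mono)
  qed
  then show ?thesis unfolding resolvent_bdd_on_def by blast
qed

lemma resolvent_bdd_on_subset: "resolvent_bdd_on Q S \<Longrightarrow> S' \<subseteq> S \<Longrightarrow> resolvent_bdd_on Q S'"
  unfolding resolvent_bdd_on_def by blast

lemma resolvent_bdd_on_nbhd:
  assumes Q: "bounded_clinear Q" and M: "\<And>x. norm x \<le> M * norm (x - w *\<^sub>C Q x)"
  shows "\<exists>e>0. resolvent_bdd_on Q (ball w e)"
proof -
  define M' where "M' = max 1 M"
  \<comment> \<open>Chosen so that the perturbation absorbs half of \<open>norm x\<close>; the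
    \<open>+ 1\<close> keeps the denominator positive when \<open>onorm Q\<close> is 0.\<close>
  define e where "e = 1 / (2 * M' * (onorm Q + 1))"
  have oQ: "onorm Q \<ge> 0" by (rule onorm_pos_le[OF bounded_clinearD(1)[OF Q]])
  have pos: "M' \<ge> 1" "e > 0" using oQ by (auto simp: M'_def e_def intro!: mult_pos_pos)
  have "norm x \<le> 2 * M' * norm (x - v *\<^sub>C Q x)" if "v \<in> ball w e" for v x
  proof -
    have "norm x \<le> M' * norm (x - w *\<^sub>C Q x)"
      using M[of x] by (rule order_trans) (simp add: M'_def mult_right_mono)
    also have "x - w *\<^sub>C Q x = (x - v *\<^sub>C Q x) + (v - w) *\<^sub>C Q x"
      by (simp add: scaleC.scale_left_diff_distrib)
    also have "norm \<dots> \<le> norm (x - v *\<^sub>C Q x) + cmod (v - w) * norm (Q x)"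
      by (metis norm_scaleC norm_triangle_ineq)
    also have "cmod (v - w) * norm (Q x) \<le> e * ((onorm Q + 1) * norm x)"
    proof (intro mult_mono)
      show "cmod (v - w) \<le> e" using that by (simp add: dist_norm norm_minus_commute)
      have "norm (Q x) \<le> onorm Q * norm x" by (rule onorm[OF bounded_clinearD(1)[OF Q]])
      then show "norm (Q x) \<le> (onorm Q + 1) * norm x" using norm_ge_zero[of x] by (simp only: distrib_right mult_1)
    qed (use pos in auto)
    finally have "norm x \<le> M' * (norm (x - v *\<^sub>C Q x) + e * ((onorm Q + 1) * norm x))"
      using pos by (simp add: mult_left_mono)
    also have "\<dots> = M' * norm (x - v *\<^sub>C Q x) + (M' * e * (onorm Q + 1)) * norm x"
      by (simp add: algebra_simps)
    also have "M' * e * (onorm Q + 1) = 1 / 2"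
      using pos oQ by (simp add: e_def field_simps)
    finally show ?thesis by simp
  qed
  then show ?thesis using pos unfolding resolvent_bdd_on_def by blast
qed

lemma resolvent_bdd_on_compact:
  assumes Q: "bounded_clinear Q" and "compact S"
    and M: "\<And>w. w \<in> S \<Longrightarrow> \<exists>M. \<forall>x. norm x \<le> M * norm (x - w *\<^sub>C Q x)"
  shows "resolvent_bdd_on Q S"
proof -
  have "\<forall>w\<in>S. \<exists>e>0. resolvent_bdd_on Q (ball w e)"
    using M resolvent_bdd_on_nbhd[OF Q] by blast
  then obtain e where e: "\<And>w. w \<in> S \<Longrightarrow> e w > 0 \<and> resolvent_bdd_on Q (ball w (e w))"
    by metis
  have "S \<subseteq> (\<Union>w\<in>S. ball w (e w))"
  proof
    fix w
    assume "w \<in> S"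
    then show "w \<in> (\<Union>w\<in>S. ball w (e w))" using e[of w] by (intro UN_I[of w]) simp_all
  qed
  then obtain C where C: "C \<subseteq> S" "finite C" "S \<subseteq> (\<Union>w\<in>C. ball w (e w))"
    by (rule compactE_image[OF \<open>compact S\<close> open_ball])
  from C(2,1) have "resolvent_bdd_on Q (\<Union>w\<in>C. ball w (e w))"
  proof (induction C)
    case empty
    then show ?case by (simp add: resolvent_bdd_on_def)
  next
    case (insert w C)
    then show ?case using resolvent_bdd_on_Un[of Q "ball w (e w)"] e by simp
  qed
  then show ?thesis using C(3) by (rule resolvent_bdd_on_subset)
qed

text \<open>
  Since \<open>wQ(I - wQ)\<^sup>-\<^sup>1 = (I - wQ)\<^sup>-\<^sup>1 - I\<close>, a bound at \<open>w\<close> persists under perturbations of \<open>w\<close>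
  that are small relative to \<open>\<bar>w\<bar>\<close>, not just to \<open>1 / \<parallel>Q\<parallel>\<close>.
\<close>

lemma resolvent_bound_perturb:
  assumes M: "norm x \<le> M * norm (x - w *\<^sub>C Q x)" "M \<ge> 0"
    and close: "2 * (1 + M) * cmod (v - w) \<le> cmod w"
  shows "norm x \<le> 2 * M * norm (x - v *\<^sub>C Q x)"
proof (cases "w = 0")
  case True
  with close M(2) have "v = w"
    by (smt (verit) mult_le_0_iff norm_le_zero_iff norm_zero eq_iff_diff_eq_0)
  with M(1) have "norm x \<le> M * norm (x - v *\<^sub>C Q x)" by simp
  also have "\<dots> \<le> 2 * M * norm (x - v *\<^sub>C Q x)" using M(2) by (intro mult_right_mono) auto
  finally show ?thesis .
next
  case False
  let ?y = "x - w *\<^sub>C Q x"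
  have "cmod w * norm (Q x) = norm (x - ?y)" by (simp add: norm_scaleC)
  also have "\<dots> \<le> norm x + norm ?y" by (rule norm_triangle_ineq4)
  also have "\<dots> \<le> (1 + M) * norm ?y" using M by (simp add: algebra_simps)
  finally have "2 * cmod (v - w) * (cmod w * norm (Q x)) \<le> 2 * cmod (v - w) * ((1 + M) * norm ?y)"
    by (intro mult_left_mono) auto
  also have "\<dots> = 2 * (1 + M) * cmod (v - w) * norm ?y" by simp
  also have "\<dots> \<le> cmod w * norm ?y" using close by (intro mult_right_mono) auto
  finally have "cmod w * (2 * (cmod (v - w) * norm (Q x))) \<le> cmod w * norm ?y"
    by (simp add: mult_ac)
  then have "2 * (cmod (v - w) * norm (Q x)) \<le> norm ?y" using False by simp
  moreover have "?y = (x - v *\<^sub>C Q x) + (v - w) *\<^sub>C Q x"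
    by (simp add: scaleC.scale_left_diff_distrib)
  then have "norm ?y \<le> norm (x - v *\<^sub>C Q x) + cmod (v - w) * norm (Q x)"
    by (metis norm_scaleC norm_triangle_ineq)
  ultimately have "norm ?y \<le> 2 * norm (x - v *\<^sub>C Q x)" by linarith
  then have "M * norm ?y \<le> M * (2 * norm (x - v *\<^sub>C Q x))" using M(2) by (rule mult_left_mono)
  then show ?thesis using M(1) by simp
qed

section \<open>Stability of bounds on half-planes\<close>

lemma half_plane_scale:
  assumes "r > 0"
  shows "half_plane (of_real r * z) = half_plane z"
proof -
  have "Re (w * cnj (of_real r * z)) = r * Re (w * cnj z)" for w
    by (simp add: algebra_simps)
  then show ?thesis using assms by (simp add: half_plane_def zero_le_mult_iff)
qed

lemma half_plane_add: "half_plane (z + z') \<subseteq> half_plane z \<union> half_plane z'"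
  by (auto simp: half_plane_def algebra_simps)

lemma half_plane_bdd_add:
  "resolvent_bdd_on Q (half_plane z) \<Longrightarrow> resolvent_bdd_on Q (half_plane z') \<Longrightarrow>
    resolvent_bdd_on Q (half_plane (z + z'))"
  by (rule resolvent_bdd_on_subset[OF resolvent_bdd_on_Un half_plane_add])

text \<open>A point \<open>w\<close> of a slightly tilted half-plane reaches
  \<open>half_plane z\<close> by a shift along \<open>z\<close> of length proportional to
  \<open>cmod w\<close>, which a relative perturbation tolerates.\<close>

lemma half_plane_bdd_open:
  assumes "resolvent_bdd_on Q (half_plane z)" "z \<noteq> 0"
  shows "\<exists>e>0. \<forall>z'\<in>ball z e. resolvent_bdd_on Q (half_plane z')"
proof -
  obtain M where M: "M \<ge> 1" "\<And>w x. w \<in> half_plane z \<Longrightarrow> norm x \<le> M * norm (x - w *\<^sub>C Q x)"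
    using assms(1) by (rule resolvent_bdd_onE) blast
  \<comment> \<open>The solution of \<open>2 * (1 + M) * d = 1 - d\<close>, where
    \<open>1 - d\<close> accounts for the shifted point being shorter than \<open>w\<close> by at
    most \<open>d * cmod w\<close>.\<close>
  define d where "d = 1 / (3 + 2 * M)"
  have d: "d > 0" using M by (simp add: d_def)
  have "norm x \<le> 2 * M * norm (x - w *\<^sub>C Q x)"
    if z': "z' \<in> ball z (d * cmod z)" and w: "w \<in> half_plane z'" for z' w x
  proof (rule resolvent_bound_perturb)
    \<comment> \<open>The shift has length \<open>d * cmod w\<close> and raises
      \<open>Re (w * cnj z)\<close> by the most that replacing \<open>z'\<close> by \<open>z\<close>
      can cost.\<close>
    define t where "t = d * cmod w / cmod z"
    let ?v = "w + of_real t * z"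
    have "Re (w * cnj (z' - z)) \<le> cmod w * cmod (z' - z)"
      by (metis complex_Re_le_cmod complex_mod_cnj norm_mult)
    also have "\<dots> \<le> cmod w * (d * cmod z)"
      using z' by (intro mult_left_mono) (auto simp: dist_norm norm_minus_commute)
    finally have "Re (w * cnj z) + cmod w * (d * cmod z) \<ge> Re (w * cnj z')"
      by (simp add: algebra_simps)
    moreover have "Re (of_real t * z * cnj z) = cmod w * (d * cmod z)"
    proof -
      have "Re (of_real t * z * cnj z) = t * (cmod z)\<^sup>2"
        unfolding cmod_power2 by (simp add: power2_eq_square algebra_simps)
      also have "\<dots> = cmod w * (d * cmod z)"
        using assms(2) by (simp add: t_def power2_eq_square)
      finally show ?thesis .
    qed
    ultimately have "?v \<in> half_plane z"
      using w by (simp add: half_plane_def distrib_right)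
    then show "norm x \<le> M * norm (x - ?v *\<^sub>C Q x)" by (rule M(2))
    have "t \<ge> 0" using d by (simp add: t_def)
    then have "cmod (of_real t * z) = t * cmod z" by (simp add: norm_mult)
    then have t: "cmod (of_real t * z) = d * cmod w" using assms(2) by (simp add: t_def)
    have "2 * (1 + M) * (d * cmod w) = cmod w - d * cmod w"
      using M(1) by (simp add: d_def field_simps)
    also have "\<dots> \<le> cmod ?v"
      using norm_triangle_ineq2[of w "- (of_real t * z)"] t by simp
    finally show "2 * (1 + M) * cmod (w - ?v) \<le> cmod ?v"
      using t by (simp add: norm_minus_commute)
  qed (use M in auto)
  then have "\<forall>z'\<in>ball z (d * cmod z). resolvent_bdd_on Q (half_plane z')"
    unfolding resolvent_bdd_on_def by blast
  moreover have "d * cmod z > 0" using d assms(2) by simp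
  ultimately show ?thesis by blast
qed

lemma half_plane_times_iff:
  assumes "z \<noteq> 0"
  shows "s * z \<in> half_plane z \<longleftrightarrow> Re s \<ge> 0"
proof -
  have "Re (s * z * cnj z) = Re s * (cmod z)\<^sup>2"
    unfolding cmod_power2 by (simp add: power2_eq_square algebra_simps)
  then show ?thesis using assms by (simp add: half_plane_def zero_le_mult_iff)
qed

text \<open>The added strip has bounded width: far out its points are relatively close to the
  boundary line of the half-plane, and the rest lies in a compact disc.\<close>

lemma half_plane_bdd_extend:
  assumes Q: "bounded_clinear Q"
    and pt: "\<And>w. \<exists>M. \<forall>x. norm x \<le> M * norm (x - w *\<^sub>C Q x)"
    and "resolvent_bdd_on Q (half_plane z)" "z \<noteq> 0"
  shows "resolvent_bdd_on Q {s * z | s. Re s > - 1/2}"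
proof -
  obtain M where M: "M \<ge> 1" "\<And>w x. w \<in> half_plane z \<Longrightarrow> norm x \<le> M * norm (x - w *\<^sub>C Q x)"
    using assms(3) by (rule resolvent_bdd_onE) blast
  \<comment> \<open>Beyond this radius the boundary point \<open>?v\<close> has modulus at least
    \<open>(1 + M) * cmod z\<close>, while its distance from \<open>w\<close> is at most half of
    \<open>cmod z\<close>.\<close>
  define b where "b = cmod z * (2 + M)"
  define S where "S = {s * z | s. Re s > - 1/2}"
  have "resolvent_bdd_on Q (half_plane z \<union> cball 0 b)"
    using assms(3) by (rule resolvent_bdd_on_Un) (rule resolvent_bdd_on_compact[OF Q _ pt], simp)
  moreover have "resolvent_bdd_on Q (S - (half_plane z \<union> cball 0 b))"
  proof -
    have "norm x \<le> 2 * M * norm (x - w *\<^sub>C Q x)" if w: "w \<in> S - (half_plane z \<union> cball 0 b)" for w x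
    proof -
      obtain s where s: "w = s * z" "Re s > - 1/2" using w by (auto simp: S_def)
      have neg: "Re s < 0" using w s(1) half_plane_times_iff[OF assms(4), of s] by auto
      let ?v = "\<i> * of_real (Im s) * z"
      have diff: "cmod (w - ?v) = \<bar>Re s\<bar> * cmod z"
      proof -
        have "w - ?v = of_real (Re s) * z"
          unfolding s(1) by (simp add: complex_eq_iff algebra_simps)
        then show ?thesis by (simp add: norm_mult)
      qed
      also have "\<dots> \<le> 1/2 * cmod z" using s neg by (intro mult_right_mono) auto
      finally have d: "cmod (w - ?v) \<le> 1/2 * cmod z" .
      have "b < cmod w" using w by (simp add: dist_norm)
      then have "b - 1/2 * cmod z \<le> cmod ?v"
        using d norm_triangle_ineq2[of w ?v] by linarith
      moreover have "2 * (1 + M) * cmod (w - ?v) \<le> 2 * (1 + M) * (1/2 * cmod z)"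
        using M d by (intro mult_left_mono) auto
      moreover have "2 * (1 + M) * (1/2 * cmod z) \<le> b - 1/2 * cmod z"
        by (simp add: b_def algebra_simps)
      ultimately have close: "2 * (1 + M) * cmod (w - ?v) \<le> cmod ?v" by linarith
      have "?v \<in> half_plane z" using half_plane_times_iff[OF assms(4)] by simp
      then show ?thesis
        using M close by (intro resolvent_bound_perturb[where w = ?v]) auto
    qed
    then show ?thesis unfolding resolvent_bdd_on_def by blast
  qed
  ultimately have "resolvent_bdd_on Q ((half_plane z \<union> cball 0 b) \<union> (S - (half_plane z \<union> cball 0 b)))"
    by (rule resolvent_bdd_on_Un)
  then show ?thesis unfolding S_def[symmetric] by (rule resolvent_bdd_on_subset) blast
qed

text \<open>The substitution \<open>s = u / (1 - u)\<close> takes the unit disc to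
  \<open>Re s > - 1/2\<close>, and \<open>(1 - u)(I - szQ) = I - u(I + zQ)\<close>. The hypothesis
  thus becomes the Ritt condition for \<open>I + zQ\<close>.\<close>

lemma resolvent_bound_imp_power_bounded:
  fixes Q :: "'a::complex_banach \<Rightarrow> 'a"
  assumes Q: "bounded_clinear Q"
    and M: "\<And>s x. Re s > - 1/2 \<Longrightarrow> norm x \<le> M * norm (x - (s * z) *\<^sub>C Q x)"
  shows "norm (((\<lambda>x. x + z *\<^sub>C Q x) ^^ n) y) \<le> 2 * exp 1 * M\<^sup>2 * norm y"
proof (rule Ritt_power_bounded)
  show "bounded_clinear (\<lambda>x. x + z *\<^sub>C Q x)"
    by (rule bounded_clinear_perturb_id[OF Q])
next
  fix u and x :: 'a
  assume u: "cmod u < 1"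
  then have u1: "u \<noteq> 1" by auto
  define s where "s = u / (1 - u)"
  have "(cmod u)\<^sup>2 < 1" using u by (simp add: power_less_one_iff)
  moreover have "(cmod (1 - u))\<^sup>2 = 1 - 2 * Re u + (cmod u)\<^sup>2"
    unfolding cmod_power2 by (simp add: power2_eq_square algebra_simps)
  ultimately have "- 1/2 * (cmod (1 - u))\<^sup>2 < Re u - (cmod u)\<^sup>2" by linarith
  moreover have "(cmod (1 - u))\<^sup>2 > 0" using u1 by simp
  moreover have "Re s = (Re u - (cmod u)\<^sup>2) / (cmod (1 - u))\<^sup>2"
    unfolding cmod_power2 by (simp add: s_def Re_divide power2_eq_square algebra_simps)
  ultimately have "Re s > - 1/2" by (simp only: pos_less_divide_eq)
  then have "cmod (1 - u) * norm x \<le> cmod (1 - u) * (M * norm (x - (s * z) *\<^sub>C Q x))"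
    by (intro mult_left_mono M) auto
  also have "\<dots> = M * norm ((1 - u) *\<^sub>C (x - (s * z) *\<^sub>C Q x))"
    by (simp add: norm_scaleC)
  also have "(1 - u) *\<^sub>C (x - (s * z) *\<^sub>C Q x) = (1 - u) *\<^sub>C x - (u * z) *\<^sub>C Q x"
    using u1 by (simp add: s_def scaleC.scale_right_diff_distrib scaleC_scaleC)
  also have "\<dots> = x - u *\<^sub>C (x + z *\<^sub>C Q x)"
    by (simp add: scaleC.scale_left_diff_distrib scaleC_add_right scaleC_scaleC)
  finally show "cmod (1 - u) * norm x \<le> M * norm (x - u *\<^sub>C (x + z *\<^sub>C Q x))" .
qed

text \<open>
  A Liouville theorem: if \<open>w\<close> ranges over the whole plane, the bound for the powers of \<open>I + zQ\<close>
  is the same for every \<open>z\<close>, and its case \<open>n = 1\<close> forces \<open>Q = 0\<close>.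
\<close>

lemma resolvent_bdd_on_UNIV:
  fixes Q :: "'a::complex_banach \<Rightarrow> 'a"
  assumes Q: "bounded_clinear Q" and "resolvent_bdd_on Q UNIV"
  shows "Q = (\<lambda>x. 0)"
proof
  fix x
  obtain M where M: "\<And>w x. norm x \<le> M * norm (x - w *\<^sub>C Q x)"
    using assms(2) by (auto simp: resolvent_bdd_on_def)
  define C where "C = 2 * exp 1 * M\<^sup>2"
  have bound: "norm (z *\<^sub>C Q x) \<le> (C + 1) * norm x" for z
  proof -
    have "norm (x + z *\<^sub>C Q x) \<le> C * norm x"
      using resolvent_bound_imp_power_bounded[where z = z and n = 1 and y = x and M = M, OF Q M] by (simp add: C_def)
    moreover have "norm (z *\<^sub>C Q x) \<le> norm (x + z *\<^sub>C Q x) + norm x"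
      by (metis add_diff_cancel_left' norm_triangle_ineq4)
    ultimately show ?thesis by (simp add: algebra_simps)
  qed
  show "Q x = 0"
  proof (rule ccontr)
    assume "Q x \<noteq> 0"
    then obtain t where t: "t > (C + 1) * norm x / norm (Q x)" "norm (Q x) > 0"
      using gt_ex by auto
    then have "(C + 1) * norm x < t * norm (Q x)" by (simp add: field_simps)
    also have "\<dots> \<le> norm (of_real t *\<^sub>C Q x)" by (simp add: norm_scaleC mult_right_mono)
    finally show False using bound[of "of_real t"] by simp
  qed
qed

section \<open>The resolvent of power bounded operators\<close>

text \<open>The inverse substitution \<open>u = s / (1 + s)\<close> has \<open>cmod u < 1\<close>,
  so the Neumann series of \<open>I - u(I + zQ)\<close> is dominated by
  \<open>C / (1 - cmod u)\<close>; multiplying by \<open>cmod (1 + s)\<close> gives the stated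
  factor.\<close>

lemma power_bounded_imp_resolvent_bound:
  fixes Q :: "'a::complex_banach \<Rightarrow> 'a"
  assumes Q: "bounded_clinear Q"
    and C: "\<And>n x. norm (((\<lambda>x. x + z *\<^sub>C Q x) ^^ n) x) \<le> C * norm x"
    and s: "Re s > - 1/2"
  shows "(cmod (1 + s) - cmod s) * norm x \<le> C * norm (x - (s * z) *\<^sub>C Q x)"
proof -
  define T where "T = (\<lambda>x. x + z *\<^sub>C Q x)"
  have T: "bounded_clinear T"
    unfolding T_def by (rule bounded_clinear_perturb_id[OF Q])
  have s1: "1 + s \<noteq> 0"
  proof
    assume "1 + s = 0"
    then have "Re (1 + s) = 0" by simp
    then show False using s by simp
  qed
  have less: "cmod s < cmod (1 + s)"
  proof -
    have "(cmod (1 + s))\<^sup>2 = (cmod s)\<^sup>2 + (1 + 2 * Re s)"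
      unfolding cmod_power2 by (simp add: power2_eq_square algebra_simps)
    then have "(cmod s)\<^sup>2 < (cmod (1 + s))\<^sup>2" using s by simp
    then show ?thesis by (rule power2_less_imp_less) simp
  qed
  define u where "u = s / (1 + s)"
  define q where "q = cmod u"
  have q: "0 \<le> q" "q < 1"
    using less s1 by (simp_all add: q_def u_def norm_divide)
  define y where "y = x - u *\<^sub>C T x"
  have C0: "C \<ge> 0 \<or> x = 0"
    using C[of 0 x] by (cases "x = 0") auto
  have y: "y = (1 / (1 + s)) *\<^sub>C (x - (s * z) *\<^sub>C Q x)"
  proof -
    have "1 - u = 1 / (1 + s)" using s1 by (simp add: u_def field_simps)
    moreover have "u * z = 1 / (1 + s) * (s * z)" by (simp add: u_def)
    moreover have "y = (1 - u) *\<^sub>C x - (u * z) *\<^sub>C Q x"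
      by (simp add: y_def T_def scaleC.scale_left_diff_distrib scaleC_add_right scaleC_scaleC)
    ultimately show ?thesis
      by (simp only: scaleC.scale_right_diff_distrib scaleC_scaleC)
  qed
  \<comment> \<open>The vector \<open>x\<close> is the truncated series at \<open>y\<close> plus the
    remainder \<open>u^N T^N x\<close>, which disappears in the limit because
    \<open>q < 1\<close>.\<close>
  have est: "norm x \<le> C * norm y / (1 - q) + q ^ N * (C * norm x)" for N
  proof (cases "x = 0")
    case True
    then show ?thesis using bounded_clinearD(5)[OF T] by (simp add: y_def)
  next
    case False
    then have C0: "C \<ge> 0" using C0 by blast
    have "norm (geom_op T N u y) \<le> (\<Sum>j<N. q ^ j * (C * norm y))"
      unfolding geom_op_def
    proof (rule sum_norm_le)
      fix j
      show "norm (u ^ j *\<^sub>C (T ^^ j) y) \<le> q ^ j * (C * norm y)"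
        using C[of j y] q by (simp add: norm_scaleC norm_power q_def T_def mult_left_mono)
    qed
    also have "\<dots> = (1 - q ^ N) / (1 - q) * (C * norm y)"
      using q by (simp add: sum_distrib_right[symmetric] sum_gp_strict)
    also have "\<dots> \<le> 1 / (1 - q) * (C * norm y)"
      using q C0 by (intro mult_right_mono divide_right_mono) auto
    finally have "norm (geom_op T N u y) \<le> C * norm y / (1 - q)" by simp
    moreover have "norm (u ^ N *\<^sub>C (T ^^ N) x) \<le> q ^ N * (C * norm x)"
      using C[of N x] q by (simp add: norm_scaleC norm_power q_def T_def mult_left_mono)
    moreover have "geom_op T N u y + u ^ N *\<^sub>C (T ^^ N) x = x"
      unfolding y_def by (simp add: geom_op_telescope'[OF T])
    then have "norm x \<le> norm (geom_op T N u y) + norm (u ^ N *\<^sub>C (T ^^ N) x)"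
      by (metis norm_triangle_ineq)
    ultimately show ?thesis by linarith
  qed
  have "(\<lambda>N. C * norm y / (1 - q) + q ^ N * (C * norm x))
      \<longlonglongrightarrow> C * norm y / (1 - q) + 0 * (C * norm x)"
    using q by (intro tendsto_intros LIMSEQ_realpow_zero) auto
  then have "norm x \<le> C * norm y / (1 - q) + 0 * (C * norm x)"
    by (rule LIMSEQ_le_const) (use est in blast)
  then have "(1 - q) * norm x \<le> C * norm y" using q by (simp add: field_simps)
  then have "cmod (1 + s) * ((1 - q) * norm x) \<le> cmod (1 + s) * (C * norm y)"
    by (rule mult_left_mono) simp
  then have "(cmod (1 + s) * (1 - q)) * norm x \<le> C * (cmod (1 + s) * norm y)"
    by (simp only: mult_ac)
  moreover have "cmod (1 + s) * norm y = norm (x - (s * z) *\<^sub>C Q x)"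
    using s1 by (simp add: y norm_scaleC norm_divide)
  moreover have "cmod (1 + s) * (1 - q) = cmod (1 + s) - cmod s"
    using s1 by (simp add: q_def u_def norm_divide right_diff_distrib)
  ultimately show ?thesis by simp
qed

text \<open>On this sector \<open>cmod (1 + s)\<close> exceeds \<open>cmod s\<close> by at least
  \<open>d\<close>, as squaring shows.\<close>

lemma power_bounded_imp_resolvent_bdd_sector:
  fixes Q :: "'a::complex_banach \<Rightarrow> 'a"
  assumes Q: "bounded_clinear Q"
    and C: "\<And>n x. norm (((\<lambda>x. x + z *\<^sub>C Q x) ^^ n) x) \<le> C * norm x"
    and d: "0 < d" "d \<le> 1"
  shows "resolvent_bdd_on Q {s * z | s. Re s \<ge> d * cmod s}"
proof -
  have "norm x \<le> C / d * norm (x - (s * z) *\<^sub>C Q x)" if "Re s \<ge> d * cmod s" for s x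
  proof -
    have s: "Re s \<ge> 0" using that d mult_nonneg_nonneg[of d "cmod s"] norm_ge_zero[of s] by linarith
    have "d \<le> cmod (1 + s) - cmod s"
    proof -
      have "(cmod s + d)\<^sup>2 \<le> (cmod (1 + s))\<^sup>2"
      proof -
        have "(cmod (1 + s))\<^sup>2 = (cmod s)\<^sup>2 + (1 + 2 * Re s)"
          unfolding cmod_power2 by (simp add: power2_eq_square algebra_simps)
        moreover have "d\<^sup>2 \<le> 1" using d by (simp add: power_le_one)
        moreover have "(cmod s + d)\<^sup>2 = (cmod s)\<^sup>2 + 2 * (d * cmod s) + d\<^sup>2"
          by (simp add: power2_sum)
        ultimately show ?thesis using that by linarith
      qed
      then show ?thesis using power2_le_imp_le[of "cmod s + d" "cmod (1 + s)"] by simp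
    qed
    then have "d * norm x \<le> (cmod (1 + s) - cmod s) * norm x" by (rule mult_right_mono) simp
    also have "\<dots> \<le> C * norm (x - (s * z) *\<^sub>C Q x)"
      by (rule power_bounded_imp_resolvent_bound[OF Q C]) (use s in auto)
    finally show ?thesis using d by (simp add: field_simps)
  qed
  then show ?thesis unfolding resolvent_bdd_on_def by blast
qed

text \<open>Turning \<open>z\<close> slightly to either side moves one boundary ray of
  \<open>half_plane z\<close> into the interior of the turned half-plane, so two proper subsectors
  suffice to cover \<open>half_plane z\<close>.\<close>

lemma power_bounded_near_imp_half_plane_bdd:
  fixes Q :: "'a::complex_banach \<Rightarrow> 'a"
  assumes Q: "bounded_clinear Q" and z: "z \<noteq> 0" and e: "0 < e" "e \<le> 1"
    and C1: "\<And>n x. norm (((\<lambda>x. x + (Complex 1 e * z) *\<^sub>C Q x) ^^ n) x) \<le> C1 * norm x"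
    and C2: "\<And>n x. norm (((\<lambda>x. x + (Complex 1 (- e) * z) *\<^sub>C Q x) ^^ n) x) \<le> C2 * norm x"
  shows "resolvent_bdd_on Q (half_plane z)"
proof (rule resolvent_bdd_on_subset)
  \<comment> \<open>The aperture \<open>e / 2\<close> comes from dividing by
    \<open>1 + f\<^sup>2\<close>, at most 2, when \<open>Re s\<close> is computed for
    \<open>s = v / Complex 1 f\<close>.\<close>
  define S where "S y = {s * y | s. Re s \<ge> e / 2 * cmod s}" for y
  show "resolvent_bdd_on Q (S (Complex 1 e * z) \<union> S (Complex 1 (- e) * z))"
    unfolding S_def
    by (intro resolvent_bdd_on_Un power_bounded_imp_resolvent_bdd_sector[OF Q C1]
        power_bounded_imp_resolvent_bdd_sector[OF Q C2]) (use e in auto)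
  have *: "v * z \<in> S (Complex 1 f * z)" if v: "Re v \<ge> 0" "Im v * f \<ge> 0" and f: "\<bar>f\<bar> = e" for v f
  proof -
    define s where "s = v / Complex 1 f"
    have nz: "Complex 1 f \<noteq> 0" by (simp add: complex_eq_iff)
    have f2: "f\<^sup>2 \<le> 1" using f e by (simp add: abs_square_le_1)
    have Im: "Im v * f = \<bar>Im v\<bar> * e"
      using v(2) f by (metis abs_mult abs_of_nonneg)
    have "1 \<le> cmod (Complex 1 f)" using complex_Re_le_cmod[of "Complex 1 f"] by simp
    then have "cmod s \<le> cmod v"
      by (simp add: s_def norm_divide divide_le_eq mult_le_cancel_left1)
    also have "\<dots> \<le> Re v + \<bar>Im v\<bar>" using cmod_le[of v] v(1) by simp
    finally have "e * cmod s \<le> e * (Re v + \<bar>Im v\<bar>)" using e by (intro mult_left_mono) auto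
    also have "\<dots> \<le> Re v + Im v * f"
    proof -
      have "e * Re v \<le> Re v" using e v(1) by (simp add: mult_left_le_one_le)
      then show ?thesis unfolding distrib_left Im by (simp add: mult.commute)
    qed
    finally have "e / 2 * cmod s \<le> (Re v + Im v * f) / 2" by simp
    also have "\<dots> \<le> (Re v + Im v * f) / (1 + f\<^sup>2)"
      using v f2 by (intro divide_left_mono) (auto simp: add_pos_nonneg)
    also have "\<dots> = Re s" by (simp add: s_def Re_divide)
    finally have "Re s \<ge> e / 2 * cmod s" .
    moreover have "v * z = s * (Complex 1 f * z)" using nz by (simp add: s_def)
    ultimately show ?thesis unfolding S_def by blast
  qed
  show "half_plane z \<subseteq> S (Complex 1 e * z) \<union> S (Complex 1 (- e) * z)"
  proof
    fix w
    assume w: "w \<in> half_plane z"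
    have wz: "w = w / z * z" using z by simp
    then have "Re (w / z) \<ge> 0" using w half_plane_times_iff[OF z, of "w / z"] by simp
    moreover have "Im (w / z) * e \<ge> 0 \<or> Im (w / z) * (- e) \<ge> 0" by linarith
    ultimately have "w / z * z \<in> S (Complex 1 e * z) \<union> S (Complex 1 (- e) * z)"
      using *[of "w / z" e] *[of "w / z" "- e"] e by auto
    then show "w \<in> S (Complex 1 e * z) \<union> S (Complex 1 (- e) * z)" using wz by simp
  qed
qed

section \<open>Open convex cones in the plane\<close>

lemma sector_add:
  assumes "sector K" "x \<in> K" "y \<in> K"
  shows "x + y \<in> K"
proof -
  have "(1/2) *\<^sub>R x + (1/2) *\<^sub>R y \<in> K"
    using assms by (intro convexD) (auto simp: sector_def)
  then have "of_real 2 * ((1/2) *\<^sub>R x + (1/2) *\<^sub>R y) \<in> K"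
    using assms(1) unfolding sector_def by (metis zero_less_numeral)
  then show ?thesis by (simp add: scaleR_conv_of_real algebra_simps)
qed

text \<open>For nonempty \<open>K\<close> the origin is a limit along any ray of \<open>K\<close>,
  but no interior point of \<open>K \<union> {0}\<close>: otherwise \<open>K\<close> would contain
  two opposite points and hence their sum 0.\<close>

lemma frontier_sector_insert_zero:
  assumes K: "sector K" "open K" "0 \<notin> K"
  shows "frontier (K \<union> {0}) = frontier K \<union> {0}"
proof (cases "K = {}")
  case True
  then show ?thesis by (simp add: frontier_def)
next
  case False
  then obtain z where z: "z \<in> K" by blast
  have "(\<lambda>n. of_real (inverse (real (Suc n))) * z) \<longlonglongrightarrow> of_real 0 * z"
    by (intro tendsto_intros LIMSEQ_inverse_real_of_nat)
  moreover have "of_real (inverse (real (Suc n))) * z \<in> K" for n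
    using K(1) z unfolding sector_def by (metis inverse_positive_iff_positive of_nat_0_less_iff zero_less_Suc)
  ultimately have cl: "0 \<in> closure K"
    unfolding closure_sequential by (intro exI[of _ "\<lambda>n. of_real (inverse (real (Suc n))) * z"]) simp
  have "0 \<notin> interior (K \<union> {0})"
  proof
    assume "0 \<in> interior (K \<union> {0})"
    then obtain e where e: "e > 0" "ball 0 e \<subseteq> K \<union> {0}" by (auto simp: mem_interior)
    have "complex_of_real (e / 2) \<in> ball 0 e" "- complex_of_real (e / 2) \<in> ball 0 e"
      using e(1) by (simp_all add: norm_divide)
    then have "complex_of_real (e / 2) \<in> K" "- complex_of_real (e / 2) \<in> K"
      using subsetD[OF e(2)] e(1) by fastforce+
    then have "complex_of_real (e / 2) + - complex_of_real (e / 2) \<in> K" by (rule sector_add[OF K(1)])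
    then show False using K(3) by simp
  qed
  then have "interior (K \<union> {0}) = K"
    using interior_subset[of "K \<union> {0}"] interior_maximal[of K "K \<union> {0}"] K(2) by blast
  moreover have "closure (K \<union> {0}) = closure K"
    using cl unfolding closure_Un by auto
  ultimately show ?thesis
    unfolding frontier_def interior_open[OF K(2)] using cl K(3) by blast
qed

text \<open>\<open>Arg\<close> takes values in \<open>{-pi<..pi}\<close>, so only the value
  \<open>pi\<close> has to be moved to \<open>-pi\<close>.\<close>

lemma cis_eq_cis_in_range:
  obtains p where "p \<in> {-pi..<pi}" "cis p = cis q"
proof (cases "Arg (cis q) = pi")
  case True
  then have "cis pi = cis q" using cis_Arg[of "cis q"] by (simp add: sgn_eq)
  then have "cis (- pi) = cis q" by (simp add: complex_eq_iff)
  then show ?thesis using that[of "- pi"] by simp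
next
  case False
  have "cis (Arg (cis q)) = cis q" using cis_Arg[of "cis q"] by (simp add: sgn_eq)
  moreover have "Arg (cis q) \<in> {-pi..<pi}" using False Arg_bounded[of "cis q"] by auto
  ultimately show ?thesis using that by blast
qed

text \<open>A hyperplane through 0 confines \<open>K\<close> to an open half-plane with normal
  \<open>a\<close>. The angles measured from \<open>a\<close> form an open interval inside the right
  angles on both sides; its midpoint gives the rotation and its half-length \<open>\<theta>\<close>,
  whence the bound \<open>pi/2\<close>.\<close>

lemma open_sector_eq_rotated_balanced_sector:
  assumes K: "sector K" "open K" "K \<noteq> {}" "0 \<notin> K"
  shows "\<exists>\<phi>\<in>{-pi..<pi}. \<exists>\<theta>\<in>{0<..pi/2}. K = (\<lambda>z. cis \<phi> * z) ` balanced_sector \<theta>"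
proof -
  have cone: "of_real r * z \<in> K" if "z \<in> K" "r > 0" for r z
    using K(1) that by (auto simp: sector_def)
  obtain a where a: "a \<noteq> 0" "\<And>x. x \<in> K \<Longrightarrow> 0 \<le> a \<bullet> x"
    using separating_hyperplane_set_0[of K] K by (auto simp: sector_def)
  \<comment> \<open>Separation gives only a weak inequality; as \<open>K\<close> is open,
    \<open>x\<close> can be moved a little against \<open>a\<close>.\<close>
  have strict: "0 < a \<bullet> x" if x: "x \<in> K" for x
  proof -
    obtain e where e: "e > 0" "ball x e \<subseteq> K" using K(2) x by (auto simp: open_contains_ball)
    define y where "y = x - (e / (2 * norm a)) *\<^sub>R a"
    have "y \<in> ball x e" using a(1) e by (simp add: y_def dist_norm)
    then have "0 \<le> a \<bullet> y" using e a by blast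
    also have "a \<bullet> y = a \<bullet> x - e / (2 * norm a) * (norm a)\<^sup>2"
      by (simp add: y_def inner_diff_right power2_norm_eq_inner)
    finally have "e / (2 * norm a) * (norm a)\<^sup>2 \<le> a \<bullet> x" by simp
    moreover have "e / (2 * norm a) * (norm a)\<^sup>2 > 0" using e a(1) by simp
    ultimately show ?thesis by linarith
  qed
  define q where "q = Arg a"
  define D where "D = {t. \<bar>t\<bar> < pi / 2 \<and> cis (q + t) \<in> K}"
  have polar: "\<exists>r t. r > 0 \<and> t \<in> D \<and> z = of_real r * cis (q + t)" if z: "z \<in> K" for z
  proof -
    define w where "w = z * cis (- q)"
    have z0: "z \<noteq> 0" using z K(4) by blast
    have "Re a = cmod a * cos q" "Im a = cmod a * sin q"
      using Re_rcis[of "cmod a" q] Im_rcis[of "cmod a" q] by (simp_all add: q_def rcis_cmod_Arg)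
    then have "cmod a * Re w = a \<bullet> z"
      by (simp add: inner_complex_def w_def algebra_simps)
    then have "Re w > 0" using strict[OF z] a(1) by (metis zero_less_mult_pos zero_less_norm_iff)
    then have "\<bar>Arg w\<bar> < pi / 2" using Arg_Re_pos by blast
    moreover have zw: "z = of_real (cmod z) * cis (q + Arg w)"
    proof -
      have "w \<noteq> 0" using \<open>Re w > 0\<close> by auto
      then have "of_real (cmod w) * cis (Arg w) = w" using cis_Arg[of w] by (simp add: sgn_eq)
      moreover have "cmod w = cmod z" by (simp add: w_def norm_mult)
      moreover have "cis q * w = z" by (simp add: w_def mult.left_commute cis_mult)
      ultimately have "z = cis q * (of_real (cmod z) * cis (Arg w))" by simp
      then show ?thesis by (simp add: cis_mult[symmetric] mult.left_commute)
    qed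
    moreover have "cis (q + Arg w) \<in> K"
    proof -
      have "of_real (1 / cmod z) * (of_real (cmod z) * cis (q + Arg w)) = cis (q + Arg w)"
        using z0 by simp
      then show ?thesis
        using cone[OF z, of "1 / cmod z"] z0 unfolding zw[symmetric] by simp
    qed
    ultimately show ?thesis using z0 by (intro exI[of _ "cmod z"] exI[of _ "Arg w"]) (simp add: D_def)
  qed
  have between: "t \<in> D" if t: "t1 \<in> D" "t2 \<in> D" "t1 < t" "t < t2" for t1 t t2
  proof -
    define A B p where "A = t2 - t" and "B = t - t1" and "p = q + t"
    have AB: "0 < A" "0 < B" "A + B < pi" using t by (auto simp: A_def B_def D_def)
    then have s: "sin A > 0" "sin B > 0" "sin (A + B) > 0" by (auto intro: sin_gt_zero)
    \<comment> \<open>With sine weights the combination of the two outer directions points exactly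
      in direction \<open>p\<close>; \<open>A + B < pi\<close> makes all weights positive.\<close>
    have "of_real (sin A) * cis (p - B) + of_real (sin B) * cis (p + A) \<in> K"
      using t by (intro sector_add[OF K(1)] cone s) (auto simp: A_def B_def p_def D_def)
    also have "of_real (sin A) * cis (p - B) + of_real (sin B) * cis (p + A) = of_real (sin (A + B)) * cis p"
      by (simp add: complex_eq_iff sin_add sin_diff cos_add cos_diff algebra_simps)
    finally have "of_real (sin (A + B)) * cis p \<in> K" .
    from cone[OF this, of "1 / sin (A + B)"] have "cis p \<in> K" using s by simp
    then show ?thesis using t by (auto simp: D_def p_def)
  qed
  have "open D"
  proof -
    have "D = {- pi / 2 <..< pi / 2} \<inter> (\<lambda>t. cis (q + t)) -` K" by (auto simp: D_def)
    moreover have "open ((\<lambda>t. cis (q + t)) -` K)"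
      by (intro open_vimage K(2) continuous_intros)
    ultimately show ?thesis by auto
  qed
  have Dne: "D \<noteq> {}" using K(3) polar by blast
  have bdd: "bdd_below D" "bdd_above D"
    by (auto simp: D_def intro!: bdd_belowI[of _ "- pi / 2"] bdd_aboveI[of _ "pi / 2"])
  define l u where "l = Inf D" and "u = Sup D"
  have D: "D = {l<..<u}"
  proof (intro equalityI subsetI)
    fix t
    assume t: "t \<in> D"
    then obtain e where e: "e > 0" "ball t e \<subseteq> D" using \<open>open D\<close> by (auto simp: open_contains_ball)
    then have "t - e / 2 \<in> D" "t + e / 2 \<in> D" by (auto simp: subset_iff dist_norm)
    then have "l \<le> t - e / 2" "t + e / 2 \<le> u"
      using bdd by (auto simp: l_def u_def intro: cInf_lower cSup_upper)
    then show "t \<in> {l<..<u}" using e by auto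
  next
    fix t
    assume t: "t \<in> {l<..<u}"
    then obtain t1 t2 where "t1 \<in> D" "t1 < t" "t2 \<in> D" "t < t2"
      using cInf_lessD[OF Dne, of t] less_cSupD[OF Dne, of t] by (auto simp: l_def u_def)
    then show "t \<in> D" using between by blast
  qed
  have "- pi / 2 \<le> l" unfolding l_def by (rule cInf_greatest[OF Dne]) (auto simp: D_def)
  moreover have "u \<le> pi / 2" unfolding u_def by (rule cSup_least[OF Dne]) (auto simp: D_def)
  moreover have "l < u" using D Dne by auto
  ultimately have th: "(u - l) / 2 \<in> {0<..pi/2}" by auto
  obtain \<phi> where \<phi>: "\<phi> \<in> {-pi..<pi}" "cis \<phi> = cis (q + (l + u) / 2)"
    by (rule cis_eq_cis_in_range)
  have "K = (\<lambda>z. cis \<phi> * z) ` balanced_sector ((u - l) / 2)"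
  proof (intro equalityI subsetI)
    fix z
    assume "z \<in> K"
    then obtain r t where rt: "r > 0" "t \<in> D" "z = of_real r * cis (q + t)" using polar by blast
    define t' where "t' = t - (l + u) / 2"
    have "t' \<in> {- ((u - l) / 2)<..<(u - l) / 2}"
      using rt(2) unfolding D t'_def by (auto simp: field_simps)
    then have "of_real r * cis t' \<in> balanced_sector ((u - l) / 2)"
      using rt(1) unfolding balanced_sector_def by blast
    moreover have "z = cis \<phi> * (of_real r * cis t')"
      unfolding \<phi> rt(3) t'_def by (simp add: mult.left_commute cis_mult)
    ultimately show "z \<in> (\<lambda>z. cis \<phi> * z) ` balanced_sector ((u - l) / 2)" by blast
  next
    fix z
    assume "z \<in> (\<lambda>z. cis \<phi> * z) ` balanced_sector ((u - l) / 2)"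
    then obtain r t where rt: "r > 0" "t \<in> {- ((u - l) / 2)<..<(u - l) / 2}"
        "z = cis \<phi> * (of_real r * cis t)"
      unfolding balanced_sector_def by blast
    have "t + (l + u) / 2 \<in> D" using rt(2) unfolding D by (auto simp: field_simps)
    then have "of_real r * cis (q + (t + (l + u) / 2)) \<in> K"
      using rt(1) by (intro cone) (auto simp: D_def)
    also have "of_real r * cis (q + (t + (l + u) / 2)) = z"
      unfolding rt(3) \<phi> by (simp add: mult.left_commute cis_mult add_ac)
    finally show "z \<in> K" .
  qed
  then show ?thesis using \<phi>(1) th by blast
qed

section \<open>Quasinilpotent operators\<close>

lemma invertible_op_inv:
  assumes "invertible_op T"
  shows "bounded_clinear (inv T)" "inv T (T x) = x" "T (inv T x) = x"
proof -
  obtain S where S: "bounded_clinear S" "S \<circ> T = id" "T \<circ> S = id"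
    using assms by (auto simp: invertible_op_def)
  then have i: "inv T = S" by (intro inv_unique_comp)
  show "bounded_clinear (inv T)" unfolding i by (rule S(1))
  show "inv T (T x) = x" "T (inv T x) = x"
    using S(2,3) unfolding i by (simp_all add: fun_eq_iff)
qed

text \<open>The bridge between the resolvent norms in \<open>R_set\<close> and lower bounds.\<close>

lemma onorm_inv_le_iff:
  assumes "invertible_op T" "M \<ge> 0"
  shows "onorm (inv T) \<le> M \<longleftrightarrow> (\<forall>x. norm x \<le> M * norm (T x))"
proof
  assume M: "onorm (inv T) \<le> M"
  show "\<forall>x. norm x \<le> M * norm (T x)"
  proof
    fix x
    have "norm (inv T (T x)) \<le> onorm (inv T) * norm (T x)"
      by (intro onorm bounded_clinearD(1) invertible_op_inv(1) assms)
    also have "\<dots> \<le> M * norm (T x)" using M by (rule mult_right_mono) simp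
    finally show "norm x \<le> M * norm (T x)" by (simp add: invertible_op_inv(2)[OF assms(1)])
  qed
next
  assume "\<forall>x. norm x \<le> M * norm (T x)"
  then have "norm (inv T x) \<le> M * norm (T (inv T x))" for x by blast
  then show "onorm (inv T) \<le> M"
    by (intro onorm_bound assms(2)) (simp add: invertible_op_inv(3)[OF assms(1)])
qed

text \<open>For nonzero \<open>w\<close> the operator is \<open>w\<close> times
  \<open>1 / w - Q\<close>, and \<open>1 / w\<close> lies outside the spectrum.\<close>

lemma quasinilpotent_invertible:
  fixes Q :: "'a::complex_banach \<Rightarrow> 'a"
  assumes "quasinilpotent Q"
  shows "invertible_op (\<lambda>x. x - w *\<^sub>C Q x)"
proof (cases "w = 0")
  case True
  then show ?thesis
    using bounded_clinear_id unfolding invertible_op_def by (auto intro!: exI[of _ "\<lambda>x. x"])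
next
  case False
  have Q: "bounded_clinear Q" using assms by (simp add: quasinilpotent_def)
  have "1 / w \<notin> op_spectrum Q" using assms False by (simp add: quasinilpotent_def)
  then obtain S where S: "bounded_clinear S" "S \<circ> (\<lambda>x. (1 / w) *\<^sub>C x - Q x) = id"
      "(\<lambda>x. (1 / w) *\<^sub>C x - Q x) \<circ> S = id"
    by (auto simp: op_spectrum_def invertible_op_def)
  have eq: "x - w *\<^sub>C Q x = w *\<^sub>C ((1 / w) *\<^sub>C x - Q x)" for x
    using False by (simp add: scaleC.scale_right_diff_distrib scaleC_scaleC)
  have S': "S ((1 / w) *\<^sub>C x - Q x) = x" "(1 / w) *\<^sub>C S x - Q (S x) = x" for x
    using S(2,3) by (simp_all add: fun_eq_iff)
  have "bounded_clinear (\<lambda>x. (1 / w) *\<^sub>C S x)"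
    by (rule bounded_clinear_compose[OF bounded_clinear_scaleC S(1)])
  moreover have "(\<lambda>x. (1 / w) *\<^sub>C S x) \<circ> (\<lambda>x. x - w *\<^sub>C Q x) = id"
    using False by (simp add: fun_eq_iff eq bounded_clinearD(2)[OF S(1)] S' scaleC_scaleC)
  moreover have "(\<lambda>x. x - w *\<^sub>C Q x) \<circ> (\<lambda>x. (1 / w) *\<^sub>C S x) = id"
    using False by (simp add: fun_eq_iff bounded_clinearD(2)[OF Q] scaleC_scaleC S')
  moreover have "bounded_clinear (\<lambda>x. x - w *\<^sub>C Q x)"
    by (intro bounded_clinear_diff bounded_clinear_id bounded_clinear_compose[OF bounded_clinear_scaleC] Q)
  ultimately show ?thesis unfolding invertible_op_def by blast
qed

lemma R_set_iff:
  assumes "quasinilpotent Q"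
  shows "z \<in> R_set Q \<longleftrightarrow> resolvent_bdd_on Q {s * z | s. Re s > - 1/2}"
proof
  note inv = quasinilpotent_invertible[OF assms]
  assume "z \<in> R_set Q"
  then obtain M where M: "\<And>s. Re s > - 1/2 \<Longrightarrow> onorm (inv (\<lambda>x. x - (s * z) *\<^sub>C Q x)) \<le> M"
    unfolding R_set_def bdd_above_def by auto
  have "norm x \<le> max 0 M * norm (x - (s * z) *\<^sub>C Q x)" if "Re s > - 1/2" for s x
    using order_trans[OF M[OF that] max.cobounded2[of M 0]]
      onorm_inv_le_iff[OF inv, of "max 0 M" "s * z"] by simp
  then show "resolvent_bdd_on Q {s * z | s. Re s > - 1/2}"
    unfolding resolvent_bdd_on_def by blast
next
  note inv = quasinilpotent_invertible[OF assms]
  assume "resolvent_bdd_on Q {s * z | s. Re s > - 1/2}"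
  then obtain M where M: "M \<ge> 1"
      "\<And>w x. w \<in> {s * z | s. Re s > - 1/2} \<Longrightarrow> norm x \<le> M * norm (x - w *\<^sub>C Q x)"
    by (rule resolvent_bdd_onE) blast
  have "onorm (inv (\<lambda>x. x - (s * z) *\<^sub>C Q x)) \<le> M" if "Re s > - 1/2" for s
    using M that onorm_inv_le_iff[OF inv, of M "s * z"] by auto
  then show "z \<in> R_set Q"
    unfolding R_set_def using inv by (auto intro!: bdd_aboveI2[of _ _ M])
qed

lemma zero_in_R_set:
  assumes "quasinilpotent Q"
  shows "0 \<in> R_set Q"
  unfolding R_set_iff[OF assms] resolvent_bdd_on_def by (rule exI[of _ 1]) auto

text \<open>The half-plane form depends only on the ray through \<open>z\<close>, which reveals the
  cone structure. The point 0 is excluded, since it always belongs to \<open>R_set Q\<close> while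
  its half-plane is the whole plane.\<close>

lemma R_set_iff_half_plane:
  assumes Q: "quasinilpotent Q" and z: "z \<noteq> 0"
  shows "z \<in> R_set Q \<longleftrightarrow> resolvent_bdd_on Q (half_plane z)"
proof
  assume "z \<in> R_set Q"
  then have "resolvent_bdd_on Q {s * z | s. Re s > - 1/2}" using R_set_iff[OF Q] by blast
  then show "resolvent_bdd_on Q (half_plane z)"
  proof (rule resolvent_bdd_on_subset)
    show "half_plane z \<subseteq> {s * z | s. Re s > - 1/2}"
    proof
      fix w
      assume w: "w \<in> half_plane z"
      have "w = w / z * z" using z by simp
      moreover from this have "Re (w / z) \<ge> 0" using w half_plane_times_iff[OF z, of "w / z"] by simp
      then have "Re (w / z) > - 1/2" by linarith
      ultimately show "w \<in> {s * z | s. Re s > - 1/2}" by blast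
    qed
  qed
next
  assume *: "resolvent_bdd_on Q (half_plane z)"
  have "\<exists>M. \<forall>x. norm x \<le> M * norm (x - w *\<^sub>C Q x)" for w
  proof -
    note inv = quasinilpotent_invertible[OF Q, of w]
    have "onorm (inv (\<lambda>x. x - w *\<^sub>C Q x)) \<ge> 0"
      by (intro onorm_pos_le bounded_clinearD(1) invertible_op_inv(1) inv)
    with onorm_inv_le_iff[OF inv this] show ?thesis by blast
  qed
  then show "z \<in> R_set Q"
    unfolding R_set_iff[OF Q]
    by (intro half_plane_bdd_extend * z) (use Q in \<open>auto simp: quasinilpotent_def\<close>)
qed

section \<open>The resolvent cone and the interior of \<open>B_set Q\<close>\<close>

lemma B_set_iff:
  fixes Q :: "'a::complex_banach \<Rightarrow> 'a"
  assumes Q: "bounded_clinear Q"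
  shows "z \<in> B_set Q \<longleftrightarrow> (\<exists>C. \<forall>n x. norm (((\<lambda>x. x + z *\<^sub>C Q x) ^^ n) x) \<le> C * norm x)"
proof
  let ?T = "\<lambda>x. x + z *\<^sub>C Q x"
  have lin: "bounded_linear (?T ^^ n)" for n
    by (intro bounded_clinearD(1) bounded_clinear_funpow bounded_clinear_perturb_id Q)
  {
    assume "z \<in> B_set Q"
    then obtain C where C: "\<And>n. onorm (?T ^^ n) \<le> C"
      unfolding B_set_def bdd_above_def by auto
    have "norm ((?T ^^ n) x) \<le> C * norm x" for n x
      using onorm[OF lin, of n x] mult_right_mono[OF C norm_ge_zero, of n x] by linarith
    then show "\<exists>C. \<forall>n x. norm ((?T ^^ n) x) \<le> C * norm x" by blast
  }
  assume "\<exists>C. \<forall>n x. norm ((?T ^^ n) x) \<le> C * norm x"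
  then obtain C where C: "\<And>n x. norm ((?T ^^ n) x) \<le> C * norm x" by blast
  have "onorm (?T ^^ n) \<le> max 0 C" for n
  proof (rule onorm_bound)
    show "norm ((?T ^^ n) x) \<le> max 0 C * norm x" for x
      using C[of n x] by (rule order_trans) (simp add: mult_right_mono)
  qed simp
  then show "z \<in> B_set Q"
    unfolding B_set_def by (auto intro!: bdd_aboveI2[of _ _ "max 0 C"])
qed

lemma resolvent_cone:
  fixes Q :: "'a::complex_banach \<Rightarrow> 'a"
  assumes Q: "bounded_clinear Q" and "Q \<noteq> (\<lambda>x. 0)"
  defines "K \<equiv> {z. resolvent_bdd_on Q (half_plane z)}"
  shows "0 \<notin> K" "open K" "sector K"
proof -
  show 0: "0 \<notin> K"
  proof
    assume "0 \<in> K"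
    moreover have "half_plane 0 = UNIV" by (auto simp: half_plane_def)
    ultimately show False using resolvent_bdd_on_UNIV[OF Q] assms(2) by (simp add: K_def)
  qed
  show "open K"
    unfolding open_contains_ball
  proof
    fix z
    assume "z \<in> K"
    moreover from this have "z \<noteq> 0" using 0 by auto
    ultimately show "\<exists>e>0. ball z e \<subseteq> K"
      using half_plane_bdd_open[of Q z] by (auto simp: K_def subset_iff)
  qed
  have cone: "of_real r * z \<in> K" if "z \<in> K" "r > 0" for z r
    using that by (simp add: K_def half_plane_scale)
  moreover have "convex K"
  proof (rule convexI)
    fix x y and u v :: real
    assume *: "x \<in> K" "y \<in> K" "0 \<le> u" "0 \<le> v" "u + v = 1"
    consider "u = 0" "v = 1" | "v = 0" "u = 1" | "u > 0" "v > 0"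
      using * by linarith
    then show "u *\<^sub>R x + v *\<^sub>R y \<in> K"
    proof cases
      case 3
      then have "of_real u * x \<in> K" "of_real v * y \<in> K" using * cone by auto
      then show ?thesis by (simp add: K_def half_plane_bdd_add scaleR_conv_of_real)
    qed (use * in auto)
  qed
  ultimately show "sector K" by (simp add: sector_def)
qed

lemma half_plane_bdd_imp_B_set:
  fixes Q :: "'a::complex_banach \<Rightarrow> 'a"
  assumes Q: "quasinilpotent Q" and z: "z \<noteq> 0" "resolvent_bdd_on Q (half_plane z)"
  shows "z \<in> B_set Q"
proof -
  have lin: "bounded_clinear Q" using Q by (simp add: quasinilpotent_def)
  have "resolvent_bdd_on Q {s * z | s. Re s > - 1/2}"
    using z R_set_iff[OF Q] R_set_iff_half_plane[OF Q] by blast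
  then obtain M where "\<And>s x. Re s > - 1/2 \<Longrightarrow> norm x \<le> M * norm (x - (s * z) *\<^sub>C Q x)"
    unfolding resolvent_bdd_on_def by blast
  from resolvent_bound_imp_power_bounded[where z = z and M = M, OF lin this]
  show ?thesis unfolding B_set_iff[OF lin] by blast
qed

lemma interior_B_set_imp_half_plane_bdd:
  fixes Q :: "'a::complex_banach \<Rightarrow> 'a"
  assumes Q: "bounded_clinear Q" and z: "z \<noteq> 0" "z \<in> interior (B_set Q)"
  shows "resolvent_bdd_on Q (half_plane z)"
proof -
  obtain d where d: "d > 0" "ball z d \<subseteq> B_set Q" using z(2) by (auto simp: mem_interior)
  \<comment> \<open>Both points \<open>(1 + ie)z\<close> and \<open>(1 - ie)z\<close> have distance
    \<open>e * cmod z\<close>, at most \<open>d / 2\<close>, from \<open>z\<close>.\<close>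
  define e where "e = min 1 (d / (2 * cmod z))"
  have e: "0 < e" "e \<le> 1" using d z by (auto simp: e_def)
  have "e * cmod z < d"
  proof -
    have "e * cmod z \<le> d / (2 * cmod z) * cmod z" by (intro mult_right_mono) (auto simp: e_def)
    also have "\<dots> < d" using d z by simp
    finally show ?thesis .
  qed
  have "Complex 1 f * z \<in> B_set Q" if "\<bar>f\<bar> = e" for f
  proof -
    have "Complex 1 f * z - z = \<i> * of_real f * z" by (simp add: complex_eq_iff algebra_simps)
    then have "dist z (Complex 1 f * z) = e * cmod z"
      using that unfolding dist_norm norm_minus_commute[of z] by (simp add: norm_mult)
    then show ?thesis using d(2) \<open>e * cmod z < d\<close> by (auto simp: subset_iff)
  qed
  from this[of e] this[of "- e"] show ?thesis
    using power_bounded_near_imp_half_plane_bdd[OF Q z(1) e] e unfolding B_set_iff[OF Q] by auto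
qed

lemma interior_B_set_eq:
  fixes Q :: "'a::complex_banach \<Rightarrow> 'a"
  assumes Q: "quasinilpotent Q" and "Q \<noteq> (\<lambda>x. 0)"
  shows "interior (B_set Q) = {z. resolvent_bdd_on Q (half_plane z)}" (is "_ = ?K")
proof
  have lin: "bounded_clinear Q" using Q by (simp add: quasinilpotent_def)
  note K = resolvent_cone[OF lin assms(2)]
  have "?K \<subseteq> B_set Q"
  proof
    fix z
    assume z: "z \<in> ?K"
    with K(1) have "z \<noteq> 0" by metis
    with z show "z \<in> B_set Q" by (simp add: half_plane_bdd_imp_B_set[OF Q])
  qed
  then show "?K \<subseteq> interior (B_set Q)" using K(2) by (rule interior_maximal)
  have sub: "interior (B_set Q) - {0} \<subseteq> ?K"
    by (simp add: interior_B_set_imp_half_plane_bdd[OF lin] subset_iff)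
  \<comment> \<open>The covering by two sectors says nothing about 0. If 0 were interior, two small
    opposite points would lie in the cone, and so would their sum 0.\<close>
  moreover have "0 \<notin> interior (B_set Q)"
  proof
    assume "0 \<in> interior (B_set Q)"
    then obtain e where e: "e > 0" "ball 0 e \<subseteq> interior (B_set Q)"
      using open_contains_ball[of "interior (B_set Q)"] by auto
    have "complex_of_real (e / 2) \<in> ball 0 e - {0}" "- complex_of_real (e / 2) \<in> ball 0 e - {0}"
      using e(1) by (simp_all add: norm_divide)
    then have "complex_of_real (e / 2) \<in> ?K" "- complex_of_real (e / 2) \<in> ?K"
      using sub e(2) by blast+
    then have "complex_of_real (e / 2) + - complex_of_real (e / 2) \<in> ?K" by (rule sector_add[OF K(3)])
    then show False using K(1) by simp
  qed
  ultimately show "interior (B_set Q) \<subseteq> ?K" by blast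
qed

text \<open>The frontier identity carries the premise that \<open>Q\<close> is nonzero: for
  \<open>Q = 0\<close> both sets are the whole plane, the frontiers are empty, and the right-hand
  side would be \<open>{0}\<close>. The whole plane counts as an open sector, so the equivalence in
  the second part includes \<open>Q = 0\<close>.\<close>

theorem theorem3p3:
  fixes Q :: "'a::complex_banach \<Rightarrow> 'a"
  assumes "quasinilpotent Q"
  shows
    "(R_set Q = interior (B_set Q) \<union> {0} \<and>
      (Q \<noteq> (\<lambda>x. 0) \<longrightarrow> frontier (R_set Q) = frontier (interior (B_set Q)) \<union> {0})) \<and>
     (R_set Q \<noteq> {0} \<longleftrightarrow>
      interior (B_set Q) \<noteq> {} \<and> open (interior (B_set Q)) \<and> sector (interior (B_set Q))) \<and>
     ((R_set Q = UNIV \<longleftrightarrow> Q = (\<lambda>x. 0)) \<and>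
      (R_set Q = {0} \<or> R_set Q = UNIV \<or>
       (\<exists>\<phi>\<in>{-pi..<pi}. \<exists>\<theta>\<in>{0<..pi/2}.
          R_set Q = (\<lambda>z. cis \<phi> * z) ` balanced_sector \<theta> \<union> {0})))"
proof (cases "Q = (\<lambda>x. 0)")
  case True
  have lin: "bounded_clinear Q" using assms by (simp add: quasinilpotent_def)
  have "resolvent_bdd_on Q S" for S
    unfolding resolvent_bdd_on_def True by (auto intro!: exI[of _ 1])
  then have R: "R_set Q = UNIV" using R_set_iff[OF assms] by blast
  have "((\<lambda>x. x + z *\<^sub>C Q x) ^^ n) x = x" for z n x
    by (induction n) (auto simp: True)
  then have B: "B_set Q = UNIV"
    unfolding set_eq_iff B_set_iff[OF lin] by (auto intro!: exI[of _ 1])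
  have "(1::complex) \<in> UNIV" by simp
  then have "(UNIV :: complex set) \<noteq> {0}" by (metis singletonD zero_neq_one)
  then show ?thesis using R B True by (simp add: sector_def)
next
  case False
  have lin: "bounded_clinear Q" using assms by (simp add: quasinilpotent_def)
  define K where "K = {z. resolvent_bdd_on Q (half_plane z)}"
  have K: "0 \<notin> K" "open K" "sector K"
    unfolding K_def by (rule resolvent_cone[OF lin False])+
  have B: "interior (B_set Q) = K"
    unfolding K_def by (rule interior_B_set_eq[OF assms False])
  have R: "R_set Q = K \<union> {0}"
  proof (rule set_eqI)
    fix z
    show "z \<in> R_set Q \<longleftrightarrow> z \<in> K \<union> {0}"
      using R_set_iff_half_plane[OF assms, of z] zero_in_R_set[OF assms]
      by (cases "z = 0") (simp_all add: K_def)
  qed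
  \<comment> \<open>This yields the implication from \<open>R_set Q = UNIV\<close> to
    \<open>Q = 0\<close>.\<close>
  have "K \<union> {0} \<noteq> UNIV"
  proof
    assume "K \<union> {0} = UNIV"
    then have "1 \<in> K \<union> {0}" "- 1 \<in> K \<union> {0}" by blast+
    then have "1 + - 1 \<in> K" by (intro sector_add[OF K(3)]) auto
    then show False using K(1) by simp
  qed
  moreover have "frontier (K \<union> {0}) = frontier K \<union> {0}"
    by (rule frontier_sector_insert_zero) (use K in auto)
  moreover have "K \<union> {0} = {0} \<longleftrightarrow> K = {}" using K(1) by auto
  moreover have "K = {} \<or> (\<exists>\<phi>\<in>{-pi..<pi}. \<exists>\<theta>\<in>{0<..pi/2}.
      K \<union> {0} = (\<lambda>z. cis \<phi> * z) ` balanced_sector \<theta> \<union> {0})"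
  proof (cases "K = {}")
    case False
    obtain \<phi> \<theta> where "\<phi> \<in> {-pi..<pi}" "\<theta> \<in> {0<..pi/2}"
        "K = (\<lambda>z. cis \<phi> * z) ` balanced_sector \<theta>"
      using open_sector_eq_rotated_balanced_sector[OF K(3,2) False K(1)] by blast
    then show ?thesis by blast
  qed simp
  ultimately show ?thesis
    unfolding R B using K(2,3) False by simp
qed

end
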